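(* Let $N\ge1$ and $1\le p<\infty$. There exists a constant $M=M(N,p,R/r)>0$, depending only on $N$, $p$ and the ratio $R/r>1$, such that for every $0<s<1$, $x_0\in\mathbb{R}^N$, $0<r<R$, every compact set $\Sigma\subseteq\overline{B_r(x_0)}$ and every $u\in C^\infty_0(\mathbb{R}^N)$ such that $u\equiv0$ on $\Sigma$, we have $$\frac{M}{r^{\frac Np}}\left(\widetilde{\mathrm{cap}}_{s,p}(\Sigma;B_R(x_0))\right)^{\frac1p}\|u\|_{L^p(B_r(x_0))}\le\left(\iint_{B_R(x_0)\times\mathbb{R}^N}\frac{|u(x)-u(y)|^p}{|x-y|^{N+s\,p}}\,dx\,dy\right)^{\frac1p}.$$ Moreover, $$0<\lim_{R/r\to1}\frac{M(N,p,R/r)}{(R/r-1)^{\frac Np+1}}<\infty\qquad\text{and}\qquad0<\lim_{R/r\to\infty}\left(\frac Rr\right)^{\frac Np}M\left(N,p,\frac Rr\right)<\infty.$$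
   Context: $B_r(x_0)$ is the open ball of centre $x_0$ and radius $r$ in $\mathbb{R}^N$. For an open set $E\subseteq\mathbb{R}^N$ and a compact set $\Sigma\subseteq E$, the relative $(s,p)$-capacity is $$\widetilde{\mathrm{cap}}_{s,p}(\Sigma;E)=\inf_{\varphi\in C^\infty_0(E)}\left\{\iint_{\mathbb{R}^N\times\mathbb{R}^N}\frac{|\varphi(x)-\varphi(y)|^p}{|x-y|^{N+sp}}\,dx\,dy:\ \varphi\ge1\text{ on }\Sigma\right\},$$ where $C^\infty_0(E)$ is the space of smooth functions with compact support in $E$. *)

theory Defs
  imports "HOL-Analysis.Analysis"
begin

text \<open>
  All integrals are extended nonnegative, so that neither a capacity nor an energy can degenerate
  to the default value of a divergent Bochner integral. The power below is the
  \<open>a\<close>-th power on \<open>[0, \<infinity>]\<close>, and is meant for \<open>a > 0\<close> only.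
\<close>

definition ennreal_powr :: "ennreal \<Rightarrow> real \<Rightarrow> ennreal" where
  "ennreal_powr x a = (if x = \<infinity> then \<infinity> else ennreal (enn2real x powr a))"

text \<open>
  Being \<open>k\<close> times differentiable, by iterated directional derivatives of Frechet derivatives;
  quantified over all \<open>k\<close> this is \<open>C\<^sup>\<infinity>\<close> (continuity of the derivatives of order \<open>k\<close> follows from
  differentiability at order \<open>k + 1\<close>).
\<close>

primrec times_differentiable :: "nat \<Rightarrow> ('a::euclidean_space \<Rightarrow> real) \<Rightarrow> bool" where
  "times_differentiable 0 f \<longleftrightarrow> continuous_on UNIV f"
| "times_differentiable (Suc k) f \<longleftrightarrow>
     (\<forall>x. f differentiable (at x)) \<and>
     (\<forall>v. times_differentiable k (\<lambda>x. frechet_derivative f (at x) v))"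

definition smooth :: "('a::euclidean_space \<Rightarrow> real) \<Rightarrow> bool" where
  "smooth f \<longleftrightarrow> (\<forall>k. times_differentiable k f)"

text \<open>
  \<open>C\<^sub>0\<^sup>\<infinity>(E)\<close> for open \<open>E\<close>; its elements are taken to be extended by zero to the whole space.
\<close>

definition test_functions :: "'a::euclidean_space set \<Rightarrow> ('a \<Rightarrow> real) set" where
  "test_functions E =
     {\<phi>. smooth \<phi> \<and> compact (closure {x. \<phi> x \<noteq> 0}) \<and> closure {x. \<phi> x \<noteq> 0} \<subseteq> E}"

text \<open>
  On the diagonal, a null set, the integrand is \<open>0 / 0 = 0\<close>.
\<close>

definition gagliardo_energy ::
    "real \<Rightarrow> real \<Rightarrow> ('a::euclidean_space \<times> 'a) set \<Rightarrow> ('a \<Rightarrow> real) \<Rightarrow> ennreal" where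
  "gagliardo_energy s p Z u =
     (\<integral>\<^sup>+z\<in>Z. (case z of (x, y) \<Rightarrow>
         ennreal (\<bar>u x - u y\<bar> powr p / norm (x - y) powr (real DIM('a) + s * p)))
       \<partial>(lborel \<Otimes>\<^sub>M lborel))"

definition rel_cap :: "real \<Rightarrow> real \<Rightarrow> 'a::euclidean_space set \<Rightarrow> 'a set \<Rightarrow> ennreal" where
  "rel_cap s p \<Sigma> E =
     (INF \<phi>\<in>{\<phi> \<in> test_functions E. \<forall>x\<in>\<Sigma>. \<phi> x \<ge> 1}. gagliardo_energy s p UNIV \<phi>)"

definition Lp_norm :: "real \<Rightarrow> 'a::euclidean_space set \<Rightarrow> ('a \<Rightarrow> real) \<Rightarrow> ennreal" where
  "Lp_norm p A u = ennreal_powr (\<integral>\<^sup>+x\<in>A. ennreal (\<bar>u x\<bar> powr p) \<partial>lborel) (1 / p)"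

end

theory Submission
  imports Defs
begin

text \<open>
Put \<open>N = DIM('a)\<close>, \<open>q = N + s * p\<close>, \<open>B = ball x0 R\<close>, and write \<open>E\<close> for the energy of \<open>u\<close> over
\<open>B \<times> UNIV\<close>.

\<^bold>\<open>The capacity controls every level of \<open>u\<close>.\<close> For a real \<open>c \<noteq> 0\<close> and a cutoff \<open>\<eta>\<close>, equal to 1 on
\<open>\<Sigma>\<close> and supported in \<open>B\<close>, the function \<open>\<eta> * (1 - u / c)\<close> competes in the definition of the
capacity, because \<open>u\<close> vanishes on \<open>\<Sigma>\<close>. A Leibniz rule for the energy gives
(\<open>rel_cap_test_inequality\<close>) \<open>\<bar>c\<bar> powr p * cap \<le> 2 powr p * (E + K * D c)\<close>, where \<open>D c\<close> is the
integral of \<open>\<bar>u x - c\<bar> powr p\<close> over \<open>B\<close> and \<open>K\<close> bounds, for every \<open>x\<close>, the integral over \<open>y\<close> of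
\<open>\<bar>\<eta> x - \<eta> y\<bar> powr p / norm (x - y) powr q\<close>; for \<open>u = 0\<close> and \<open>c = 1\<close> it bounds the capacity itself.
Since \<open>\<bar>u\<bar> powr p\<close> is at most a constant times \<open>\<bar>c\<bar> powr p + \<bar>u - c\<bar> powr p\<close>, both facts together
estimate \<open>cap\<close> times the integral of \<open>\<bar>u\<bar> powr p\<close> by \<open>E\<close> and \<open>K * D c\<close>. No single good value of
\<open>c\<close> has to be found: one takes \<open>c = u y\<close> and averages over \<open>y\<close> in \<open>B\<close>, which replaces \<open>D c\<close> by the
\<open>oscillation\<close> of \<open>u\<close>, the double integral of \<open>\<bar>u x - u y\<bar> powr p\<close> over \<open>B \<times> B\<close>.

\<^bold>\<open>Uniformity in \<open>s\<close>.\<close> The number \<open>K\<close> is of size \<open>1 / s + 1 / (1 - s)\<close>: its two parts are the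
integral of \<open>norm h powr (p - q)\<close> near the origin (\<open>core_integral\<close>) and that of \<open>norm h powr - q\<close>
near infinity (\<open>tail_integral\<close>). So the oscillation must be bounded by \<open>E\<close> with both a factor
\<open>1 - s\<close> and a factor \<open>s\<close>.

The factor \<open>1 - s\<close> comes from passing to midpoints: a difference over \<open>x, y\<close> is at most the sum of
two differences over half the distance, whence the oscillation at scale \<open>\<rho>\<close> is at most
\<open>2 powr (p + N)\<close> times the one at scale \<open>\<rho> / 2\<close>. The kernel \<open>\<rho> powr - q\<close> loses only the factor
\<open>2 powr (p * (1 - s))\<close> in this comparison, which tends to 1 as \<open>s\<close> tends to 1, while constants
lose \<open>2 powr (p + N)\<close>; comparing the two isolates the oscillation with the coefficient
\<open>2 powr (p * (1 - s)) - 1\<close> (\<open>oscillation_le_near\<close>). Exactly this coefficient appears when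
\<open>core_integral\<close> is summed over dyadic rings (\<open>core_integral_bound\<close>), so the two cancel.

The factor \<open>s\<close> comes from the part of the energy with \<open>y\<close> far from \<open>B\<close>: comparing \<open>u x\<close> and \<open>u x'\<close>
through \<open>u y\<close> bounds directly the product of the oscillation with \<open>tail_integral\<close>
(\<open>oscillation_le_far\<close>), and \<open>tail_integral\<close> itself never has to be computed.

\<^bold>\<open>The constant.\<close> As the cutoff has Lipschitz constant of order \<open>1 / (R - r)\<close>, this yields
\<open>cap * I \<le> C * R powr N * (R / (R - r)) powr p * E\<close> with \<open>I\<close> the integral of \<open>\<bar>u\<bar> powr p\<close> over
\<open>ball x0 r\<close> and \<open>C\<close> depending on \<open>N\<close> and \<open>p\<close> only, and an explicit \<open>M\<close> with the two prescribed
asymptotic rates is below the optimal constant of this inequality.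
\<close>

section \<open>Closure properties of smooth functions\<close>

lemma times_differentiable_const: "times_differentiable k (\<lambda>x. c)"
  by (induction k arbitrary: c) auto

lemma times_differentiable_linear:
  assumes "bounded_linear f"
  shows "times_differentiable k f"
proof (cases k)
  case 0
  then show ?thesis
    using assms by (simp add: linear_continuous_on)
next
  case (Suc j)
  have "frechet_derivative f (at x) = f" for x
    using frechet_derivative_at[OF bounded_linear_imp_has_derivative[OF assms]] by simp
  then show ?thesis
    using Suc bounded_linear_imp_differentiable[OF assms]
    by (auto simp: times_differentiable_const)
qed

lemma times_differentiable_SucD:
  "times_differentiable (Suc k) f \<Longrightarrow> times_differentiable k f"
proof (induction k arbitrary: f)
  case 0
  then show ?case
    by (auto simp: continuous_on_eq_continuous_at intro!: differentiable_imp_continuous_within)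
qed auto

lemma times_differentiable_SucI:
  assumes "\<And>x. (f has_derivative D x) (at x)"
    and "\<And>v. times_differentiable k (\<lambda>x. D x v)"
  shows "times_differentiable (Suc k) f"
proof -
  have "frechet_derivative f (at x) = D x" for x
    using frechet_derivative_at[OF assms(1)] by simp
  then show ?thesis
    using assms by (auto simp: differentiable_def)
qed

lemma times_differentiable_frechet_derivative:
  assumes "times_differentiable (Suc k) f"
  shows "(f has_derivative frechet_derivative f (at x)) (at x)"
    and "times_differentiable k (\<lambda>x. frechet_derivative f (at x) v)"
  using assms by (auto simp: frechet_derivative_works)

lemma times_differentiable_add:
  "times_differentiable k f \<Longrightarrow> times_differentiable k g \<Longrightarrow> times_differentiable k (\<lambda>x. f x + g x)"
proof (induction k arbitrary: f g)
  case 0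
  then show ?case by (auto intro: continuous_intros)
next
  case (Suc k)
  define D where "D x = frechet_derivative f (at x)" for x
  have D: "(f has_derivative D x) (at x)" "times_differentiable k (\<lambda>x. D x v)" for x v
    unfolding D_def by (rule times_differentiable_frechet_derivative[OF Suc.prems(1)])+
  define D' where "D' x = frechet_derivative g (at x)" for x
  have D': "(g has_derivative D' x) (at x)" "times_differentiable k (\<lambda>x. D' x v)" for x v
    unfolding D'_def by (rule times_differentiable_frechet_derivative[OF Suc.prems(2)])+
  show ?case
    by (rule times_differentiable_SucI[where D = "\<lambda>x v. D x v + D' x v"])
       (use D D' in \<open>auto intro!: Suc.IH has_derivative_add\<close>)
qed

lemma times_differentiable_mult:
  "times_differentiable k f \<Longrightarrow> times_differentiable k g \<Longrightarrow> times_differentiable k (\<lambda>x. f x * g x)"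
proof (induction k arbitrary: f g)
  case 0
  then show ?case by (auto intro: continuous_intros)
next
  case (Suc k)
  define D where "D x = frechet_derivative f (at x)" for x
  have D: "(f has_derivative D x) (at x)" "times_differentiable k (\<lambda>x. D x v)" for x v
    unfolding D_def by (rule times_differentiable_frechet_derivative[OF Suc.prems(1)])+
  define D' where "D' x = frechet_derivative g (at x)" for x
  have D': "(g has_derivative D' x) (at x)" "times_differentiable k (\<lambda>x. D' x v)" for x v
    unfolding D'_def by (rule times_differentiable_frechet_derivative[OF Suc.prems(2)])+
  have k: "times_differentiable k f" "times_differentiable k g"
    using Suc.prems by (auto dest: times_differentiable_SucD simp del: times_differentiable.simps)
  show ?case
    by (rule times_differentiable_SucI[where D = "\<lambda>x v. f x * D' x v + D x v * g x"])
       (use D D' k in \<open>auto intro!: Suc.IH times_differentiable_add has_derivative_mult\<close>)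
qed

lemma times_differentiable_inverse:
  assumes "\<And>x. f x \<noteq> 0"
  shows "times_differentiable k f \<Longrightarrow> times_differentiable k (\<lambda>x. inverse (f x))"
proof (induction k)
  case 0
  then show ?case using assms by (auto intro: continuous_intros)
next
  case (Suc k)
  define D where "D x = frechet_derivative f (at x)" for x
  have D: "(f has_derivative D x) (at x)" "times_differentiable k (\<lambda>x. D x v)" for x v
    unfolding D_def by (rule times_differentiable_frechet_derivative[OF Suc.prems(1)])+
  have k: "times_differentiable k (\<lambda>x. inverse (f x))"
    using Suc by (auto dest: times_differentiable_SucD simp del: times_differentiable.simps)
  show ?case
  proof (rule times_differentiable_SucI)
    show "((\<lambda>x. inverse (f x)) has_derivative (\<lambda>v. - (inverse (f x) * D x v * inverse (f x)))) (at x)"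
        for x
      by (rule Deriv.has_derivative_inverse[OF assms D(1)])
    have "times_differentiable k (\<lambda>x. - 1 * (inverse (f x) * D x v * inverse (f x)))" for v
      by (intro times_differentiable_mult times_differentiable_const D k)
    then show "times_differentiable k (\<lambda>x. - (inverse (f x) * D x v * inverse (f x)))" for v
      by simp
  qed
qed

text \<open>
The outer function comes as the whole sequence \<open>g 0, g 1, \<dots>\<close> of its successive derivatives: the
chain rule passes from \<open>g n\<close> to \<open>g (Suc n)\<close>, so the induction must cover all members at once.
\<close>
lemma times_differentiable_compose:
  fixes g :: "nat \<Rightarrow> real \<Rightarrow> real"
  assumes g: "\<And>n t. (g n has_real_derivative g (Suc n) t) (at t)"
  shows "times_differentiable k f \<Longrightarrow> times_differentiable k (\<lambda>x. g n (f x))"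
proof (induction k arbitrary: n)
  case 0
  have "continuous_on UNIV (g n)"
    using g by (meson DERIV_isCont continuous_at_imp_continuous_on)
  with 0 show ?case
    using continuous_on_compose2[of UNIV "g n" UNIV f] by simp
next
  case (Suc k)
  define D where "D x = frechet_derivative f (at x)" for x
  have D: "(f has_derivative D x) (at x)" "times_differentiable k (\<lambda>x. D x v)" for x v
    unfolding D_def by (rule times_differentiable_frechet_derivative[OF Suc.prems(1)])+
  have k: "times_differentiable k (\<lambda>x. g n (f x))" for n
    using Suc by (auto dest: times_differentiable_SucD simp del: times_differentiable.simps)
  show ?case
  proof (rule times_differentiable_SucI[where D = "\<lambda>x v. g (Suc n) (f x) * D x v"])
    show "((\<lambda>x. g n (f x)) has_derivative (\<lambda>v. g (Suc n) (f x) * D x v)) (at x)" for x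
      using has_derivative_compose[OF D(1) g[unfolded has_field_derivative_def]]
      by (simp add: o_def)
  qed (use D k in \<open>auto intro!: times_differentiable_mult\<close>)
qed

lemma smooth_compose:
  fixes h :: "real \<Rightarrow> real"
  assumes "smooth h" "smooth f"
  shows "smooth (\<lambda>x. h (f x))"
proof -
  define g where "g n = ((\<lambda>h x. frechet_derivative h (at x) (1::real)) ^^ n) h" for n
  have smooth_g: "smooth (g n)" for n
  proof (induction n)
    case (Suc n)
    have "times_differentiable k (g (Suc n))" for k
      using Suc unfolding smooth_def by (auto simp: g_def dest: spec[where x = "Suc k"])
    then show ?case by (simp add: smooth_def)
  qed (use assms(1) in \<open>simp add: g_def\<close>)
  have "(g n has_real_derivative g (Suc n) t) (at t)" for n t
  proof -
    have "g n differentiable (at t)"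
      using smooth_g[of n] by (auto simp: smooth_def dest: spec[where x = "Suc 0"])
    then have d: "(g n has_derivative frechet_derivative (g n) (at t)) (at t)"
      by (simp add: frechet_derivative_works)
    have "frechet_derivative (g n) (at t) = (*) (g (Suc n) t)"
    proof
      fix v
      have "linear (frechet_derivative (g n) (at t))"
        using d has_derivative_linear by blast
      from linear_scale[OF this, of v 1] show "frechet_derivative (g n) (at t) v = g (Suc n) t * v"
        by (simp add: g_def mult.commute)
    qed
    with d show ?thesis by (simp add: has_field_derivative_def)
  qed
  from times_differentiable_compose[where g = g and n = 0, OF this] show ?thesis
    using assms(2) by (auto simp: smooth_def g_def)
qed

section \<open>Smooth cutoff functions\<close>

text \<open>
The case \<open>P = 1\<close> is the standard smooth function that is flat at the origin. General polynomials
make the family closed under differentiation, as \<open>times_differentiable_compose\<close> requires.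
\<close>
definition poly_exp :: "real poly \<Rightarrow> real \<Rightarrow> real" where
  "poly_exp P x = (if 0 < x then poly P (inverse x) * exp (- inverse x) else 0)"

lemma poly_over_exp_tendsto_0: "((\<lambda>x. poly P x * exp (- x)) \<longlongrightarrow> (0::real)) at_top"
proof -
  have "((\<lambda>x. \<Sum>i\<le>degree P. coeff P i * (x ^ i / exp x)) \<longlongrightarrow> (\<Sum>i\<le>degree P. coeff P i * 0)) at_top"
    by (intro tendsto_intros tendsto_power_div_exp_0)
  then show ?thesis
    by (simp add: poly_altdef sum_divide_distrib sum_distrib_right exp_minus field_simps)
qed

lemma poly_exp_has_derivative:
  "(poly_exp P has_real_derivative poly_exp ([:0, 0, 1:] * (P - pderiv P)) x) (at x)"
proof -
  consider "0 < x" | "x < 0" | "x = 0" by linarith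
  then show ?thesis
  proof cases
    case 1
    have "((\<lambda>x. poly P (inverse x) * exp (- inverse x)) has_real_derivative
        poly_exp ([:0, 0, 1:] * (P - pderiv P)) x) (at x)"
      using 1 by (auto intro!: derivative_eq_intros DERIV_chain2[OF poly_DERIV]
          simp: poly_exp_def field_simps power2_eq_square)
    then show ?thesis
      by (rule has_field_derivative_transform_within_open[where S = "{0<..}"])
         (use 1 in \<open>auto simp: poly_exp_def\<close>)
  next
    case 2
    have "((\<lambda>x. 0) has_real_derivative 0) (at x)" by simp
    then have "(poly_exp P has_real_derivative 0) (at x)"
      by (rule has_field_derivative_transform_within_open[where S = "{..<0}"])
         (use 2 in \<open>auto simp: poly_exp_def\<close>)
    with 2 show ?thesis by (simp add: poly_exp_def)
  next
    case 3
    have "((\<lambda>h. poly ([:0, 1:] * P) (inverse h) * exp (- inverse h)) \<longlongrightarrow> 0) (at_right 0)"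
      by (rule filterlim_compose[OF poly_over_exp_tendsto_0 filterlim_inverse_at_top_right])
    then have "((\<lambda>h. poly_exp P h / h) \<longlongrightarrow> 0) (at_right 0)"
      by (rule Lim_transform_eventually)
         (auto simp: poly_exp_def eventually_at_filter field_simps)
    moreover have "((\<lambda>h. poly_exp P h / h) \<longlongrightarrow> 0) (at_left 0)"
      by (rule tendsto_eventually) (auto simp: poly_exp_def eventually_at_filter)
    ultimately have "((\<lambda>h. poly_exp P h / h) \<longlongrightarrow> 0) (at 0)"
      by (simp add: filterlim_split_at)
    then have "((\<lambda>h. (poly_exp P (0 + h) - poly_exp P 0) / h) \<longlongrightarrow> 0) (at 0)"
      by (simp add: poly_exp_def)
    then show ?thesis
      using 3 by (simp add: DERIV_def poly_exp_def)
  qed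
qed

lemma smooth_poly_exp: "smooth (poly_exp P)"
proof -
  have "times_differentiable k (\<lambda>x. ((\<lambda>n. poly_exp
      (((\<lambda>P. [:0, 0, 1:] * (P - pderiv P)) ^^ n) P)) 0) (id x))" for k
    by (rule times_differentiable_compose)
       (use poly_exp_has_derivative times_differentiable_linear[OF bounded_linear_ident]
         in \<open>auto simp: id_def simp del: mult_pCons_left\<close>)
  then show ?thesis by (simp add: smooth_def)
qed

lemma smooth_const: "smooth (\<lambda>x. c)"
  by (simp add: smooth_def times_differentiable_const)

lemma smooth_linear: "bounded_linear f \<Longrightarrow> smooth f"
  by (simp add: smooth_def times_differentiable_linear)

lemma smooth_add: "smooth f \<Longrightarrow> smooth g \<Longrightarrow> smooth (\<lambda>x. f x + g x)"
  by (simp add: smooth_def times_differentiable_add)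

lemma smooth_mult: "smooth f \<Longrightarrow> smooth g \<Longrightarrow> smooth (\<lambda>x. f x * g x)"
  by (simp add: smooth_def times_differentiable_mult)

lemma smooth_inverse: "smooth f \<Longrightarrow> (\<And>x. f x \<noteq> 0) \<Longrightarrow> smooth (\<lambda>x. inverse (f x))"
  by (simp add: smooth_def times_differentiable_inverse)


lemma smooth_affine_real: "smooth (\<lambda>x::real. a + b * x)"
  by (intro smooth_add smooth_const smooth_linear bounded_linear_mult_right)

lemma smooth_norm_diff_power2: "smooth (\<lambda>x::'a::euclidean_space. (norm (x - a))\<^sup>2)"
proof -
  have sq: "smooth (\<lambda>x::'a. (- (a \<bullet> i) + x \<bullet> i) * (- (a \<bullet> i) + x \<bullet> i))" for i
    by (intro smooth_mult smooth_add smooth_const smooth_linear bounded_linear_inner_left)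
  have "smooth (\<lambda>x. \<Sum>i\<in>S. (- (a \<bullet> i) + x \<bullet> i) * (- (a \<bullet> i) + x \<bullet> i))"
    if "finite S" for S :: "'a set"
    using that by induction
      (simp_all only: sum.insert sum.empty smooth_const sq smooth_add finite.insertI not_False_eq_True)
  from this[of Basis] show ?thesis
    unfolding power2_norm_eq_inner
    by (subst euclidean_inner) (simp add: inner_diff_left)
qed

lemma smooth_continuous: "smooth f \<Longrightarrow> continuous_on UNIV f"
  by (auto simp: smooth_def dest: spec[where x = 0])

text \<open>
With \<open>f x = exp (- 1 / x)\<close> for \<open>x > 0\<close> and \<open>f x = 0\<close> otherwise, \<open>f (1 - x) / (f (1 - x) + f x)\<close>
has these properties: its denominator never vanishes, and its derivative is continuous and lives
on \<open>{0..1}\<close>, hence is bounded.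
\<close>
lemma smooth_transition_exists:
  "\<exists>(\<theta>::real \<Rightarrow> real) L. smooth \<theta> \<and> (\<forall>x\<le>0. \<theta> x = 1) \<and> (\<forall>x\<ge>1. \<theta> x = 0) \<and>
    (\<forall>x. 0 \<le> \<theta> x) \<and> (\<forall>x. \<theta> x \<le> 1) \<and> 1 \<le> L \<and> (\<forall>x y. \<bar>\<theta> x - \<theta> y\<bar> \<le> L * \<bar>x - y\<bar>)"
proof -
  define f where "f = poly_exp 1"
  define \<theta> where "\<theta> x = f (1 + (-1) * x) * inverse (f (1 + (-1) * x) + f x)" for x
  have f0: "0 \<le> f x" for x by (simp add: f_def poly_exp_def)
  have f_pos: "0 < f x \<longleftrightarrow> 0 < x" and f_zero: "x \<le> 0 \<Longrightarrow> f x = 0" for x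
    by (simp_all add: f_def poly_exp_def)
  have sum_pos: "0 < f (1 + (-1) * x) + f x" for x
    using f0[of x] f0[of "1 + (-1) * x"] f_pos[of x] f_pos[of "1 + (-1) * x"]
    by (cases "0 < x") (auto intro: add_nonneg_pos add_pos_nonneg)
  have smooth_f: "smooth f" unfolding f_def by (rule smooth_poly_exp)
  have smooth: "smooth \<theta>"
    unfolding \<theta>_def using sum_pos
    by (intro smooth_mult smooth_inverse smooth_add smooth_compose[OF smooth_f] smooth_affine_real smooth_f)
       (metis less_irrefl sum_pos)
  have one: "\<theta> x = 1" if "x \<le> 0" for x
    using f_zero[OF that] sum_pos[of x] by (simp add: \<theta>_def)
  have zero: "\<theta> x = 0" if "1 \<le> x" for x
    using f_zero[of "1 - x"] that by (simp add: \<theta>_def)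
  have nonneg: "0 \<le> \<theta> x" and le1: "\<theta> x \<le> 1" for x
    using f0[of x] f0[of "1 + (-1) * x"] sum_pos[of x] by (auto simp: \<theta>_def field_simps)
  have "times_differentiable (Suc 0) \<theta>" using smooth by (auto simp: smooth_def)
  define D where "D x = frechet_derivative \<theta> (at x)" for x
  have D: "(\<theta> has_derivative D x) (at x)" "times_differentiable 0 (\<lambda>x. D x v)" for x v
    unfolding D_def by (rule times_differentiable_frechet_derivative[OF \<open>times_differentiable (Suc 0) \<theta>\<close>])+
  have D1: "(\<theta> has_real_derivative D x 1) (at x)" for x
  proof -
    have "linear (D x)" using D(1) has_derivative_linear by blast
    then have "D x v = D x 1 * v" for v
      using linear_scale[of "D x" v 1] by simp
    then show ?thesis using D(1)[of x] by (metis has_derivative_imp_has_field_derivative mult.commute)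
  qed
  have "continuous_on {0..1} (\<lambda>x. D x 1)"
    by (rule continuous_on_subset[of UNIV]) (use D(2)[of 1] in auto)
  then have "bounded ((\<lambda>x. D x 1) ` {0..1})"
    by (intro compact_imp_bounded compact_continuous_image) auto
  then obtain L0 where L0: "\<And>x. 0 \<le> x \<Longrightarrow> x \<le> 1 \<Longrightarrow> \<bar>D x 1\<bar> \<le> L0"
    unfolding bounded_iff by (metis atLeastAtMost_iff imageI real_norm_def)
  define L where "L = max L0 1"
  have lip01: "\<bar>\<theta> x - \<theta> y\<bar> \<le> L * \<bar>x - y\<bar>" if "x \<in> {0..1}" "y \<in> {0..1}" for x y
  proof -
    have "norm (\<theta> x - \<theta> y) \<le> L * norm (x - y)"
      by (rule field_differentiable_bound[where S = "{0..1}" and f' = "\<lambda>x. D x 1"])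
         (use that L0 D1 in \<open>auto simp: L_def le_max_iff_disj intro: has_field_derivative_at_within\<close>)
    then show ?thesis by simp
  qed
  have clamp: "\<theta> x = \<theta> (max 0 (min 1 x))" for x
    using one[of x] one[of 0] zero[of x] zero[of 1] by (auto simp: max_def min_def)
  have "\<bar>\<theta> x - \<theta> y\<bar> \<le> L * \<bar>x - y\<bar>" for x y
  proof -
    have "\<bar>\<theta> x - \<theta> y\<bar> \<le> L * \<bar>max 0 (min 1 x) - max 0 (min 1 y)\<bar>"
      unfolding clamp[of x] clamp[of y] by (rule lip01) auto
    also have "\<dots> \<le> L * \<bar>x - y\<bar>"
      by (rule mult_left_mono) (auto simp: L_def)
    finally show ?thesis .
  qed
  then show ?thesis
    using smooth one zero nonneg le1 by (intro exI[of _ \<theta>] exI[of _ L]) (auto simp: L_def)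
qed

lemma test_functions_mult:
  assumes "\<eta> \<in> test_functions E" "smooth w"
  shows "(\<lambda>x. \<eta> x * w x) \<in> test_functions E"
proof -
  have sub: "closure {x. \<eta> x * w x \<noteq> 0} \<subseteq> closure {x. \<eta> x \<noteq> 0}"
    by (intro closure_mono) auto
  moreover have "bounded (closure {x. \<eta> x \<noteq> 0})"
    using assms(1) by (auto simp: test_functions_def intro: compact_imp_bounded)
  ultimately have "compact (closure {x. \<eta> x * w x \<noteq> 0})"
    by (auto simp: compact_eq_bounded_closed intro: bounded_subset)
  with sub assms show ?thesis
    by (auto simp: test_functions_def intro: smooth_mult)
qed

lemma test_function_continuous: "\<phi> \<in> test_functions E \<Longrightarrow> continuous_on UNIV \<phi>"
  by (simp add: test_functions_def smooth_continuous)

text \<open>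
Compose the transition function with an affine function of \<open>(norm (x - x0))\<^sup>2\<close>, which unlike the
norm is smooth at \<open>x0\<close>. The Lipschitz constant does not suffer from the square: over the shell
\<open>r \<le> norm (x - x0) \<le> R'\<close> the square grows by \<open>(R' - r) * (R' + r)\<close> and its slope is at most
\<open>2 * R'\<close>.
\<close>
lemma cutoff_exists:
  obtains L :: real where "1 \<le> L" and
    "\<And>(x0::'a::euclidean_space) r R. 0 < r \<Longrightarrow> r < R \<Longrightarrow>
      \<exists>\<eta> \<in> test_functions (ball x0 R). (\<forall>x\<in>cball x0 r. \<eta> x = 1) \<and> (\<forall>x. 0 \<le> \<eta> x \<and> \<eta> x \<le> 1)
        \<and> (\<forall>x y. \<bar>\<eta> x - \<eta> y\<bar> \<le> L / (R - r) * norm (x - y))"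
proof -
  obtain \<theta> :: "real \<Rightarrow> real" and L where
    "smooth \<theta>" "\<forall>x\<le>0. \<theta> x = 1" "\<forall>x\<ge>1. \<theta> x = 0" "\<forall>x. 0 \<le> \<theta> x" "\<forall>x. \<theta> x \<le> 1" "1 \<le> L"
    "\<forall>x y. \<bar>\<theta> x - \<theta> y\<bar> \<le> L * \<bar>x - y\<bar>"
    using smooth_transition_exists by blast
  note \<theta> = this[rule_format]
  have "\<exists>\<eta> \<in> test_functions (ball x0 R). (\<forall>x\<in>cball x0 r. \<eta> x = 1) \<and> (\<forall>x. 0 \<le> \<eta> x \<and> \<eta> x \<le> 1)
        \<and> (\<forall>x y. \<bar>\<eta> x - \<eta> y\<bar> \<le> (4 * L) / (R - r) * norm (x - y))"
    if r: "0 < r" "r < R" for x0 :: 'a and r R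
  proof -
    \<comment> \<open>Leaves room for the closed support inside the open ball.\<close>
    define R' where "R' = (r + R) / 2"
    have R': "r < R'" "R' < R" using r by (auto simp: R'_def)
    define q where "q t = - r\<^sup>2 / (R'\<^sup>2 - r\<^sup>2) + 1 / (R'\<^sup>2 - r\<^sup>2) * t" for t
    define \<eta> where "\<eta> x = \<theta> (q ((norm (x - x0))\<^sup>2))" for x
    have pos: "0 < R'\<^sup>2 - r\<^sup>2" using R' r by (simp add: power_strict_mono)
    have q_eq: "q t = (t - r\<^sup>2) / (R'\<^sup>2 - r\<^sup>2)" for t
      by (simp add: q_def diff_divide_distrib)
    have "smooth (\<lambda>x. q ((norm (x - x0))\<^sup>2))" unfolding q_def
      by (intro smooth_compose[of "\<lambda>t. _ + _ * t", OF smooth_affine_real] smooth_norm_diff_power2)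
    then have smooth: "smooth \<eta>" unfolding \<eta>_def by (rule smooth_compose[OF \<theta>(1)])
    have one: "\<eta> x = 1" if "x \<in> cball x0 r" for x
    proof -
      have "(norm (x - x0))\<^sup>2 \<le> r\<^sup>2" using that by (simp add: dist_norm norm_minus_commute power_mono)
      then show ?thesis using pos by (auto simp: \<eta>_def q_eq divide_nonpos_pos intro!: \<theta>(2))
    qed
    have zero: "\<eta> x = 0" if "R' \<le> norm (x - x0)" for x
    proof -
      have "R'\<^sup>2 \<le> (norm (x - x0))\<^sup>2" using that R' r by (intro power_mono) auto
      then show ?thesis using pos by (auto simp: \<eta>_def q_eq intro!: \<theta>(3))
    qed
    have "{x. \<eta> x \<noteq> 0} \<subseteq> cball x0 R'"
      using zero by (auto simp: dist_norm norm_minus_commute) (meson linorder_le_cases)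
    then have sub: "closure {x. \<eta> x \<noteq> 0} \<subseteq> cball x0 R'"
      by (rule closure_minimal) simp
    then have "compact (closure {x. \<eta> x \<noteq> 0})"
      by (meson bounded_cball bounded_subset closed_closure compact_eq_bounded_closed)
    moreover have "cball x0 R' \<subseteq> ball x0 R" using R' by auto
    ultimately have test: "\<eta> \<in> test_functions (ball x0 R)"
      using smooth sub by (auto simp: test_functions_def)
    have lip: "\<bar>\<eta> x - \<eta> y\<bar> \<le> (4 * L) / (R - r) * norm (x - y)" for x y
    proof -
      \<comment> \<open>Beyond \<open>R'\<close> the cutoff vanishes, so the radius may be truncated; this keeps the slope
        of the square bounded.\<close>
      define m where "m x = min R' (norm (x - x0))" for x
      have m: "0 \<le> m x" "m x \<le> R'" for x using R' r by (auto simp: m_def)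
      have \<eta>_m: "\<eta> x = \<theta> (q ((m x)\<^sup>2))" for x
        using zero[of x] \<theta>(3)[of "q (R'\<^sup>2)"] pos by (auto simp: m_def min_def \<eta>_def q_eq)
      have "\<bar>\<eta> x - \<eta> y\<bar> \<le> L * \<bar>q ((m x)\<^sup>2) - q ((m y)\<^sup>2)\<bar>"
        unfolding \<eta>_m by (rule \<theta>(7))
      also have "q ((m x)\<^sup>2) - q ((m y)\<^sup>2) = (m x + m y) * (m x - m y) / (R'\<^sup>2 - r\<^sup>2)"
        by (simp add: q_eq diff_divide_distrib[symmetric] power2_eq_square algebra_simps)
      also have "\<bar>\<dots>\<bar> = (m x + m y) * \<bar>m x - m y\<bar> / (R'\<^sup>2 - r\<^sup>2)"
        using m[of x] m[of y] pos by (simp add: abs_mult)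
      also have "\<dots> \<le> (2 * R') * norm (x - y) / ((R' - r) * R')"
      proof (rule frac_le)
        have "\<bar>m x - m y\<bar> \<le> \<bar>norm (x - x0) - norm (y - x0)\<bar>"
          by (auto simp: m_def min_def)
        also have "\<dots> \<le> norm (x - y)"
          using norm_triangle_ineq3[of "x - x0" "y - x0"] by simp
        finally show "(m x + m y) * \<bar>m x - m y\<bar> \<le> 2 * R' * norm (x - y)"
          using m[of x] m[of y] by (intro mult_mono) auto
        show "(R' - r) * R' \<le> R'\<^sup>2 - r\<^sup>2"
          using mult_right_mono[of r R' r] r R' by (simp add: power2_eq_square algebra_simps)
      qed (use R' r in auto)
      also have "\<dots> = 4 / (R - r) * norm (x - y)"
      proof -
        have "0 < R'" using r R' by simp
        have e: "R' - r = (R - r) / 2" by (simp add: R'_def field_simps)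
        show ?thesis unfolding e using \<open>0 < R'\<close> by simp
      qed
      finally show ?thesis using \<theta>(6) by (simp add: mult_left_mono mult_ac)
    qed
    show ?thesis
      by (rule bexI[OF _ test]) (use one lip \<theta> in \<open>auto simp: \<eta>_def\<close>)
  qed
  with that[of "4 * L"] \<theta>(6) show ?thesis by auto
qed

section \<open>Integrals of the kernel\<close>

lemma nn_integral_lborel_affine:
  fixes f :: "'a::euclidean_space \<Rightarrow> ennreal"
  assumes [measurable]: "f \<in> borel_measurable borel" and "0 < c"
  shows "(\<integral>\<^sup>+x. f x \<partial>lborel) = ennreal (c ^ DIM('a)) * (\<integral>\<^sup>+x. f (t + c *\<^sub>R x) \<partial>lborel)"
  using assms(2) by (subst lborel_affine[of c t])
    (simp_all add: nn_integral_density nn_integral_distr nn_integral_cmult abs_of_pos)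

text \<open>
The substitution of \<open>c *\<^sub>R h\<close> for \<open>h\<close>: the Jacobian cancels against the part of the kernel that is
homogeneous of degree \<open>- DIM('a)\<close>.
\<close>
lemma kernel_scaling:
  fixes F :: "'a::euclidean_space \<Rightarrow> real"
  assumes [measurable]: "F \<in> borel_measurable borel" and c: "0 < c"
  shows "(\<integral>\<^sup>+h. ennreal (F h / norm h powr (real DIM('a) + a)) \<partial>lborel) =
    ennreal (c powr (- a)) * (\<integral>\<^sup>+h. ennreal (F (c *\<^sub>R h) / norm h powr (real DIM('a) + a)) \<partial>lborel)"
proof -
  have *: "c ^ DIM('a) * (x / (c * norm h) powr (real DIM('a) + a)) =
      c powr (- a) * (x / norm h powr (real DIM('a) + a))" for x and h :: 'a
    using c by (simp add: powr_mult powr_add powr_realpow powr_minus_divide)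
  have "(\<integral>\<^sup>+h. ennreal (F h / norm h powr (real DIM('a) + a)) \<partial>lborel) =
      (\<integral>\<^sup>+h. ennreal (c ^ DIM('a))
          * ennreal (F (c *\<^sub>R h) / (c * norm h) powr (real DIM('a) + a)) \<partial>lborel)"
    using c by (subst nn_integral_lborel_affine[OF _ c, where t = 0]) (simp_all add: nn_integral_cmult)
  also have "\<dots> = (\<integral>\<^sup>+h. ennreal (c powr (- a))
      * ennreal (F (c *\<^sub>R h) / norm h powr (real DIM('a) + a)) \<partial>lborel)"
    using c * by (simp add: ennreal_mult'[symmetric])
  finally show ?thesis by (simp add: nn_integral_cmult)
qed

definition core_integral :: "'a::euclidean_space itself \<Rightarrow> real \<Rightarrow> real \<Rightarrow> ennreal" where
  "core_integral T s p = (\<integral>\<^sup>+h. ennreal (of_bool (norm (h::'a) < 1) * norm h powr p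
      / norm h powr (real DIM('a) + s * p)) \<partial>lborel)"

definition tail_integral :: "'a::euclidean_space itself \<Rightarrow> real \<Rightarrow> real \<Rightarrow> real \<Rightarrow> ennreal" where
  "tail_integral T s p \<rho> = (\<integral>\<^sup>+h. ennreal (of_bool (\<rho> \<le> norm (h::'a))
      / norm h powr (real DIM('a) + s * p)) \<partial>lborel)"

lemma tail_integral_scaling:
  assumes "0 < \<rho>" "0 < \<sigma>"
  shows "tail_integral TYPE('a::euclidean_space) s p \<rho> =
      ennreal ((\<sigma> / \<rho>) powr (s * p)) * tail_integral TYPE('a) s p \<sigma>"
proof -
  have "tail_integral TYPE('a) s p \<rho> = ennreal ((\<rho> / \<sigma>) powr (- (s * p))) *
      (\<integral>\<^sup>+h. ennreal (of_bool (\<rho> \<le> norm ((\<rho> / \<sigma>) *\<^sub>R (h::'a)))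
          / norm h powr (real DIM('a) + s * p)) \<partial>lborel)"
    unfolding tail_integral_def using assms by (intro kernel_scaling) auto
  moreover have "\<rho> \<le> norm ((\<rho> / \<sigma>) *\<^sub>R h) \<longleftrightarrow> \<sigma> \<le> norm h" for h :: 'a
    using assms by (simp add: field_simps)
  moreover have "(\<rho> / \<sigma>) powr (- (s * p)) = (\<sigma> / \<rho>) powr (s * p)"
    using assms by (simp add: powr_minus_divide powr_divide)
  ultimately show ?thesis by (simp add: tail_integral_def)
qed

lemma truncated_kernel_integral:
  assumes \<delta>: "0 < \<delta>"
  shows "(\<integral>\<^sup>+h. ennreal (min 1 (norm (h::'a::euclidean_space) / \<delta>) powr p
      / norm h powr (real DIM('a) + s * p)) \<partial>lborel) =
    ennreal (\<delta> powr - (s * p)) * (core_integral TYPE('a) s p + tail_integral TYPE('a) s p 1)"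
proof -
  have "(\<integral>\<^sup>+h. ennreal (min 1 (norm (h::'a) / \<delta>) powr p / norm h powr (real DIM('a) + s * p)) \<partial>lborel) =
    ennreal (\<delta> powr - (s * p))
        * (\<integral>\<^sup>+h. ennreal (min 1 (norm (\<delta> *\<^sub>R (h::'a)) / \<delta>) powr p
            / norm h powr (real DIM('a) + s * p)) \<partial>lborel)"
    using \<delta> by (intro kernel_scaling) auto
  also have "(\<lambda>h::'a. ennreal (min 1 (norm (\<delta> *\<^sub>R h) / \<delta>) powr p / norm h powr (real DIM('a) + s * p))) =
     (\<lambda>h. ennreal (of_bool (norm h < 1) * norm h powr p / norm h powr (real DIM('a) + s * p))
        + ennreal (of_bool (1 \<le> norm h) / norm h powr (real DIM('a) + s * p)))"
    using \<delta> by (auto simp: fun_eq_iff min_def)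
  finally show ?thesis
    by (simp add: core_integral_def tail_integral_def nn_integral_add)
qed

text \<open>
Split the unit ball into the dyadic rings \<open>1/2 \<le> 2 ^ n * norm h < 1\<close>. By homogeneity the integral
over the \<open>n\<close>-th ring is \<open>(1 / \<theta>) ^ n\<close> times that over the first, where \<open>\<theta> = 2 powr (p * (1 - s))\<close>;
the geometric series sums to \<open>\<theta> / (\<theta> - 1)\<close>, and the factor \<open>\<theta> - 1\<close> on the left removes the
singularity at \<open>s = 1\<close>.
\<close>
lemma core_integral_bound:
  assumes p: "0 < p" and s: "0 < s" "s < 1"
  shows "ennreal (2 powr (p * (1 - s)) - 1) * core_integral TYPE('a::euclidean_space) s p
    \<le> ennreal (2 powr p * 2 ^ DIM('a) * unit_ball_vol (real DIM('a)))"
proof -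
  define a where "a = p * (1 - s)"
  define \<theta> :: real where "\<theta> = 2 powr a"
  have a: "0 < a" "0 < DIM('a)" using p s by (auto simp: a_def)
  have \<theta>: "1 < \<theta>" using a by (simp add: \<theta>_def)
  define q where "q = real DIM('a) + s * p"
  define ring where "ring c h = of_bool (1/2 \<le> norm h / c \<and> norm h / c < 1) * norm h powr p"
    for c :: real and h :: 'a
  have [measurable]: "ring c \<in> borel_measurable borel" for c unfolding ring_def by measurable
  have ring_bound: "(\<integral>\<^sup>+h. ennreal (ring 1 h / norm h powr q) \<partial>lborel) \<le>
      ennreal (2 ^ DIM('a) * unit_ball_vol (real DIM('a)))"
  proof -
    have "(\<integral>\<^sup>+h. ennreal (ring 1 h / norm h powr q) \<partial>lborel) \<le>
        (\<integral>\<^sup>+h. ennreal (2 ^ DIM('a)) * indicator (ball (0::'a) 1) h \<partial>lborel)"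
    proof (intro nn_integral_mono)
      fix h :: 'a
      show "ennreal (ring 1 h / norm h powr q) \<le> ennreal (2 ^ DIM('a)) * indicator (ball 0 1) h"
      proof (cases "1/2 \<le> norm h \<and> norm h < 1")
        case True
        then have h0: "0 < norm h" by linarith
        have "norm h powr p / norm h powr q = norm h powr a / norm h ^ DIM('a)"
          using h0 by (simp add: q_def a_def powr_diff[symmetric] powr_realpow[symmetric] algebra_simps)
        also have "\<dots> \<le> 1 / (1/2) ^ DIM('a)"
          using True a by (intro frac_le power_mono powr_le1) auto
        finally show ?thesis
          using True by (auto simp: ring_def power_one_over intro!: ennreal_leI)
      qed (auto simp: ring_def)
    qed
    also have "\<dots> = ennreal (2 ^ DIM('a) * unit_ball_vol (real DIM('a)))"
      by (subst nn_integral_cmult_indicator) (simp_all add: emeasure_ball ennreal_mult')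
    finally show ?thesis .
  qed
  have scaled: "(\<integral>\<^sup>+h. ennreal (ring (1 / 2 ^ n) h / norm h powr q) \<partial>lborel) =
      ennreal ((1 / \<theta>) ^ n) * (\<integral>\<^sup>+h. ennreal (ring 1 h / norm h powr q) \<partial>lborel)" for n :: nat
  proof -
    define c :: real where "c = 1 / 2 ^ n"
    have c: "0 < c" by (simp add: c_def)
    have rc: "ring c (c *\<^sub>R h) = c powr p * ring 1 h" for h
      using c by (simp add: ring_def powr_mult)
    have "(\<integral>\<^sup>+h. ennreal (ring c h / norm h powr q) \<partial>lborel) =
        ennreal (c powr - (s * p))
            * (\<integral>\<^sup>+h. ennreal (c powr p) * ennreal (ring 1 h / norm h powr q) \<partial>lborel)"
      unfolding q_def using c
      by (subst kernel_scaling[OF _ c]) (simp_all add: rc ennreal_mult'[symmetric] times_divide_eq_right)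
    also have "\<dots> = ennreal (c powr - (s * p) * c powr p)
        * (\<integral>\<^sup>+h. ennreal (ring 1 h / norm h powr q) \<partial>lborel)"
      by (simp add: nn_integral_cmult ennreal_mult' mult.assoc)
    also have "c powr - (s * p) * c powr p = (1 / \<theta>) ^ n"
    proof -
      have c_eq: "c = 2 powr (- real n)"
        by (simp add: c_def powr_realpow powr_minus_divide)
      have "c powr - (s * p) * c powr p = c powr a"
        using c by (simp add: powr_add[symmetric] a_def algebra_simps)
      also have "\<dots> = (2 powr (- a)) powr real n"
        unfolding c_eq by (simp add: powr_powr mult.commute del: minus_mult_left)
      also have "\<dots> = (1 / \<theta>) ^ n"
        by (simp add: powr_realpow \<theta>_def powr_minus_divide)
      finally show ?thesis .
    qed
    finally show ?thesis by (simp add: c_def)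
  qed
  have "core_integral TYPE('a) s p \<le> (\<integral>\<^sup>+h. (\<Sum>n. ennreal (ring (1 / 2 ^ n) h / norm h powr q)) \<partial>lborel)"
    unfolding core_integral_def q_def[symmetric]
  proof (intro nn_integral_mono)
    fix h :: 'a
    show "ennreal (of_bool (norm h < 1) * norm h powr p / norm h powr q) \<le>
        (\<Sum>n. ennreal (ring (1 / 2 ^ n) h / norm h powr q))"
    proof (cases "0 < norm h \<and> norm h < 1")
      case True
      define n where "n = (LEAST n. 1/2 \<le> norm h * 2 ^ n)"
      obtain m where "1 / norm h < 2 ^ m" using real_arch_pow[of 2] by auto
      then have "1/2 \<le> norm h * 2 ^ m" using True by (simp add: field_simps)
      then have n1: "1/2 \<le> norm h * 2 ^ n" unfolding n_def by (rule LeastI)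
      have n2: "norm h * 2 ^ n < 1"
      proof (cases n)
        case (Suc k)
        then have "\<not> 1/2 \<le> norm h * 2 ^ k"
          using not_less_Least[of k "\<lambda>n. 1/2 \<le> norm h * 2 ^ n"] by (simp add: n_def)
        with Suc show ?thesis by simp
      qed (use True in simp)
      have "ennreal (of_bool (norm h < 1) * norm h powr p / norm h powr q) =
          ennreal (ring (1 / 2 ^ n) h / norm h powr q)"
        using n1 n2 True by (simp add: ring_def)
      also have "\<dots> \<le> (\<Sum>n. ennreal (ring (1 / 2 ^ n) h / norm h powr q))"
        using sum_le_suminf[of "\<lambda>n. ennreal (ring (1 / 2 ^ n) h / norm h powr q)" "{n}"] by simp
      finally show ?thesis .
    qed auto
  qed
  also have "\<dots> = (\<Sum>n. ennreal ((1 / \<theta>) ^ n) * (\<integral>\<^sup>+h. ennreal (ring 1 h / norm h powr q) \<partial>lborel))"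
    by (subst nn_integral_suminf) (simp_all add: scaled)
  also have "\<dots> = (\<Sum>n. ennreal ((1 / \<theta>) ^ n)) * (\<integral>\<^sup>+h. ennreal (ring 1 h / norm h powr q) \<partial>lborel)"
    by simp
  also have "(\<Sum>n. ennreal ((1 / \<theta>) ^ n)) = ennreal (1 / (1 - 1 / \<theta>))"
    using \<theta> by (subst suminf_ennreal2) (auto simp: suminf_geometric intro!: summable_geometric)
  also have "1 / (1 - 1 / \<theta>) = \<theta> / (\<theta> - 1)" using \<theta> by (simp add: field_simps)
  finally have "ennreal (\<theta> - 1) * core_integral TYPE('a) s p \<le>
      ennreal (\<theta> - 1) * (ennreal (\<theta> / (\<theta> - 1)) * ennreal (2 ^ DIM('a) * unit_ball_vol (real DIM('a))))"
    using mult_left_mono[OF ring_bound, of "ennreal (\<theta> / (\<theta> - 1))"]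
    by (intro mult_left_mono) (auto intro: order_trans)
  also have "\<dots> = ennreal (\<theta> * (2 ^ DIM('a) * unit_ball_vol (real DIM('a))))"
    using \<theta> by (simp add: ennreal_mult'[symmetric])
  also have "\<dots> \<le> ennreal (2 powr p * 2 ^ DIM('a) * unit_ball_vol (real DIM('a)))"
    using p s by (auto simp: \<theta>_def a_def algebra_simps intro!: ennreal_leI mult_right_mono)
  finally show ?thesis by (simp add: \<theta>_def a_def)
qed

section \<open>Bounding the oscillation by the energy\<close>

lemma powr_abs_add_le:
  fixes a b p :: real
  assumes "1 \<le> p"
  shows "\<bar>a + b\<bar> powr p \<le> 2 powr (p - 1) * (\<bar>a\<bar> powr p + \<bar>b\<bar> powr p)"
proof (cases "a = 0 \<or> b = 0")
  case True
  have "1 * (\<bar>a\<bar> powr p + \<bar>b\<bar> powr p) \<le> 2 powr (p - 1) * (\<bar>a\<bar> powr p + \<bar>b\<bar> powr p)"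
    using assms by (intro mult_right_mono ge_one_powr_ge_zero) auto
  with True show ?thesis by auto
next
  case False
  have "((\<bar>a\<bar> + \<bar>b\<bar>) / 2) powr p \<le> (\<bar>a\<bar> powr p + \<bar>b\<bar> powr p) / 2"
    using convex_onD[OF powr_convex[OF assms], of "1/2" "\<bar>a\<bar>" "\<bar>b\<bar>"] False
    by (simp add: field_simps)
  moreover have "\<bar>a + b\<bar> powr p \<le> (\<bar>a\<bar> + \<bar>b\<bar>) powr p"
    using assms by (intro powr_mono2) auto
  ultimately show ?thesis
    by (simp add: powr_divide powr_diff field_simps)
qed

lemma powr_abs_diff_le:
  fixes a b c p :: real
  assumes "1 \<le> p"
  shows "\<bar>a - b\<bar> powr p \<le> 2 powr (p - 1) * (\<bar>a - c\<bar> powr p + \<bar>c - b\<bar> powr p)"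
  using powr_abs_add_le[OF assms, of "a - c" "c - b"] by simp

lemma gagliardo_energy_iterated:
  fixes u :: "'a::euclidean_space \<Rightarrow> real"
  assumes [measurable]: "u \<in> borel_measurable borel" "B \<in> sets borel"
  shows "gagliardo_energy s p (B \<times> UNIV) u =
      (\<integral>\<^sup>+x\<in>B. (\<integral>\<^sup>+y. ennreal (\<bar>u x - u y\<bar> powr p
          / norm (x - y) powr (real DIM('a) + s * p)) \<partial>lborel) \<partial>lborel)"
proof -
  have "gagliardo_energy s p (B \<times> UNIV) u =
      (\<integral>\<^sup>+x. \<integral>\<^sup>+y. ennreal (\<bar>u x - u y\<bar> powr p / norm (x - y) powr (real DIM('a) + s * p))
          * indicator (B \<times> UNIV) (x, y) \<partial>lborel \<partial>lborel)"
    unfolding gagliardo_energy_def by (subst lborel.nn_integral_fst[symmetric]) (simp_all, measurable)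
  also have "\<dots> = (\<integral>\<^sup>+x\<in>B. (\<integral>\<^sup>+y. ennreal (\<bar>u x - u y\<bar> powr p
      / norm (x - y) powr (real DIM('a) + s * p)) \<partial>lborel) \<partial>lborel)"
    by (intro nn_integral_cong) (simp add: indicator_def)
  finally show ?thesis .
qed

text \<open>
Insert the midpoint \<open>z\<close> of \<open>x\<close> and \<open>y\<close>, which lies in \<open>B\<close> by convexity, and substitute
\<open>y = 2 z - x\<close>: the Jacobian is \<open>2 ^ DIM('a)\<close> and \<open>norm (x - y) = 2 * norm (x - z)\<close>.
\<close>
lemma midpoint_inequality:
  fixes u :: "'a::euclidean_space \<Rightarrow> real" and \<kappa> :: "real \<Rightarrow> ennreal"
  assumes p: "1 \<le> p" and B: "convex B"
    and [measurable]: "B \<in> sets borel" "u \<in> borel_measurable borel" "\<kappa> \<in> borel_measurable borel"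
  shows "(\<integral>\<^sup>+x\<in>B. (\<integral>\<^sup>+y\<in>B. ennreal (\<bar>u x - u y\<bar> powr p) * \<kappa> (norm (x - y)) \<partial>lborel) \<partial>lborel)
    \<le> ennreal (2 powr (p + DIM('a))) *
      (\<integral>\<^sup>+x\<in>B. (\<integral>\<^sup>+y\<in>B. ennreal (\<bar>u x - u y\<bar> powr p) * \<kappa> (2 * norm (x - y)) \<partial>lborel) \<partial>lborel)"
    (is "?L \<le> _ * ?R")
proof -
  define H where "H x y = ennreal (\<bar>u x - u ((1/2) *\<^sub>R (x + y))\<bar> powr p) * \<kappa> (norm (x - y))
      * indicator B y * indicator B x" for x y
  have [measurable]: "case_prod H \<in> borel_measurable (lborel \<Otimes>\<^sub>M lborel)"
    unfolding H_def by measurable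
  have H: "(\<integral>\<^sup>+y. H x y \<partial>lborel) \<le>
      ennreal (2 ^ DIM('a)) * (\<integral>\<^sup>+z\<in>B. ennreal (\<bar>u x - u z\<bar> powr p) * \<kappa> (2 * norm (x - z)) \<partial>lborel)
          * indicator B x" for x
  proof (cases "x \<in> B")
    case True
    have "(\<integral>\<^sup>+y. H x y \<partial>lborel) = ennreal (2 ^ DIM('a)) * (\<integral>\<^sup>+z. H x (- x + 2 *\<^sub>R z) \<partial>lborel)"
      by (intro nn_integral_lborel_affine) (simp_all add: H_def)
    also have "\<dots> \<le> ennreal (2 ^ DIM('a))
        * (\<integral>\<^sup>+z\<in>B. ennreal (\<bar>u x - u z\<bar> powr p) * \<kappa> (2 * norm (x - z)) \<partial>lborel)"
    proof (intro mult_left_mono nn_integral_mono)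
      fix z :: 'a
      have "z \<in> B" if "- x + 2 *\<^sub>R z \<in> B"
        using convexD[OF B True that, of "1/2" "1/2"] by (simp add: algebra_simps)
      moreover have "norm (x - (- x + 2 *\<^sub>R z)) = 2 * norm (x - z)"
      proof -
        have "x - (- x + 2 *\<^sub>R z) = 2 *\<^sub>R (x - z)" by (simp add: algebra_simps scaleR_2)
        then show ?thesis by (simp del: scaleR_right_diff_distrib)
      qed
      ultimately show "H x (- x + 2 *\<^sub>R z) \<le>
          ennreal (\<bar>u x - u z\<bar> powr p) * \<kappa> (2 * norm (x - z)) * indicator B z"
        by (auto simp: H_def indicator_def)
    qed simp
    finally show ?thesis using True by simp
  qed (simp add: H_def)
  have "?L = (\<integral>\<^sup>+x. \<integral>\<^sup>+y. ennreal (\<bar>u x - u y\<bar> powr p) * \<kappa> (norm (x - y)) * indicator B y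
      * indicator B x \<partial>lborel \<partial>lborel)"
    by (subst nn_integral_multc[symmetric]) simp_all
  also have "\<dots> \<le> (\<integral>\<^sup>+x. \<integral>\<^sup>+y. ennreal (2 powr (p - 1)) * (H x y + H y x) \<partial>lborel \<partial>lborel)"
  proof (intro nn_integral_mono)
    fix x y :: 'a
    let ?z = "(1/2) *\<^sub>R (x + y)"
    have "ennreal (\<bar>u x - u y\<bar> powr p) \<le>
        ennreal (2 powr (p - 1)) * (ennreal (\<bar>u x - u ?z\<bar> powr p) + ennreal (\<bar>u y - u ?z\<bar> powr p))"
      using powr_abs_diff_le[OF p, of "u x" "u y" "u ?z"]
      by (simp add: ennreal_mult'[symmetric] ennreal_plus[symmetric] abs_minus_commute[of "u y"]
          del: ennreal_plus)
    then have "ennreal (\<bar>u x - u y\<bar> powr p) * (\<kappa> (norm (x - y)) * indicator B y * indicator B x) \<le>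
       ennreal (2 powr (p - 1)) * (ennreal (\<bar>u x - u ?z\<bar> powr p) + ennreal (\<bar>u y - u ?z\<bar> powr p))
           * (\<kappa> (norm (x - y)) * indicator B y * indicator B x)"
      by (rule mult_right_mono) simp
    also have "\<dots> = ennreal (2 powr (p - 1)) * (H x y + H y x)"
      by (simp add: H_def algebra_simps norm_minus_commute add.commute)
    finally show "ennreal (\<bar>u x - u y\<bar> powr p) * \<kappa> (norm (x - y)) * indicator B y * indicator B x \<le>
        ennreal (2 powr (p - 1)) * (H x y + H y x)"
      by (simp add: mult.assoc)
  qed
  also have "\<dots> = ennreal (2 powr (p - 1))
      * ((\<integral>\<^sup>+x. \<integral>\<^sup>+y. H x y \<partial>lborel \<partial>lborel) + (\<integral>\<^sup>+x. \<integral>\<^sup>+y. H y x \<partial>lborel \<partial>lborel))"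
    by (simp add: nn_integral_cmult nn_integral_add)
  also have "(\<integral>\<^sup>+x. \<integral>\<^sup>+y. H y x \<partial>lborel \<partial>lborel) = (\<integral>\<^sup>+x. \<integral>\<^sup>+y. H x y \<partial>lborel \<partial>lborel)"
    by (rule lborel_pair.Fubini') simp
  also have "ennreal (2 powr (p - 1))
      * ((\<integral>\<^sup>+x. \<integral>\<^sup>+y. H x y \<partial>lborel \<partial>lborel) + (\<integral>\<^sup>+x. \<integral>\<^sup>+y. H x y \<partial>lborel \<partial>lborel))
     = ennreal (2 powr p) * (\<integral>\<^sup>+x. \<integral>\<^sup>+y. H x y \<partial>lborel \<partial>lborel)"
  proof -
    have "ennreal (2 powr p) = ennreal (2 powr (p - 1)) * 2"
      by (simp add: powr_diff ennreal_mult''[symmetric] flip: ennreal_numeral)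
    then show ?thesis by (simp add: mult.assoc mult_2[symmetric])
  qed
  also have "\<dots> \<le> ennreal (2 powr p)
      * (\<integral>\<^sup>+x. ennreal (2 ^ DIM('a))
          * (\<integral>\<^sup>+z\<in>B. ennreal (\<bar>u x - u z\<bar> powr p) * \<kappa> (2 * norm (x - z)) \<partial>lborel)
              * indicator B x \<partial>lborel)"
    by (intro mult_left_mono nn_integral_mono H) simp
  also have "\<dots> = ennreal (2 powr p) * (ennreal (2 ^ DIM('a)) * ?R)"
    by (subst nn_integral_cmult[symmetric]) (simp_all add: mult.assoc)
  also have "\<dots> = ennreal (2 powr (p + DIM('a))) * ?R"
    by (simp add: powr_add powr_realpow ennreal_mult' mult.assoc)
  finally show ?thesis .
qed

lemma nn_integral_set_times:
  fixes F :: "'a::euclidean_space \<Rightarrow> 'a \<Rightarrow> ennreal"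
  assumes [measurable]: "case_prod F \<in> borel_measurable (borel \<Otimes>\<^sub>M borel)" "A \<in> sets borel" "B \<in> sets borel"
  shows "(\<integral>\<^sup>+z\<in>A \<times> B. F (fst z) (snd z) \<partial>(lborel \<Otimes>\<^sub>M lborel)) =
      (\<integral>\<^sup>+x\<in>A. (\<integral>\<^sup>+y\<in>B. F x y \<partial>lborel) \<partial>lborel)"
proof -
  have "(\<integral>\<^sup>+z\<in>A \<times> B. F (fst z) (snd z) \<partial>(lborel \<Otimes>\<^sub>M lborel)) =
      (\<integral>\<^sup>+x. \<integral>\<^sup>+y. F x y * indicator (A \<times> B) (x, y) \<partial>lborel \<partial>lborel)"
    by (subst lborel.nn_integral_fst[symmetric]) simp_all
  also have "\<dots> = (\<integral>\<^sup>+x\<in>A. (\<integral>\<^sup>+y\<in>B. F x y \<partial>lborel) \<partial>lborel)"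
  proof (rule nn_integral_cong)
    show "(\<integral>\<^sup>+y. F x y * indicator (A \<times> B) (x, y) \<partial>lborel) = (\<integral>\<^sup>+y\<in>B. F x y \<partial>lborel) * indicator A x"
        for x
      by (cases "x \<in> A") (simp_all add: indicator_times)
  qed
  finally show ?thesis .
qed

definition oscillation :: "real \<Rightarrow> 'a::euclidean_space set \<Rightarrow> ('a \<Rightarrow> real) \<Rightarrow> ennreal" where
  "oscillation p B u = (\<integral>\<^sup>+z\<in>B \<times> B. ennreal (\<bar>u (fst z) - u (snd z)\<bar> powr p) \<partial>(lborel \<Otimes>\<^sub>M lborel))"

text \<open>
Apply the midpoint inequality with the weight \<open>\<kappa> \<rho> = \<rho> powr - q - b\<close>. As
\<open>2 powr (p + N) * \<kappa> (2 * \<rho>) = \<theta> * \<rho> powr - q - 2 powr (p + N) * b\<close> with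
\<open>\<theta> = 2 powr (p * (1 - s))\<close>, and \<open>E'\<close> and \<open>Y\<close> denoting the energy over \<open>B \<times> B\<close> and the oscillation,
it says \<open>E' - b * Y \<le> \<theta> * E' - 2 powr (p + N) * b * Y\<close>, which leaves \<open>b * Y \<le> (\<theta> - 1) * E'\<close>
because \<open>2 powr (p + N)\<close> is at least \<open>2\<close>.
\<close>
lemma oscillation_le_near:
  fixes u :: "'a::euclidean_space \<Rightarrow> real"
  assumes p: "1 \<le> p" and s: "0 < s" "s < 1" and R: "0 < R"
    and [measurable]: "u \<in> borel_measurable borel"
  shows "oscillation p (ball x0 R) u \<le>
    ennreal ((4 * R) powr (real DIM('a) + s * p) * (2 powr (p * (1 - s)) - 1)) *
      gagliardo_energy s p (ball x0 R \<times> UNIV) u"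
proof -
  define B where "B = ball x0 R"
  have [measurable]: "B \<in> sets borel" by (simp add: B_def)
  define q where "q = real DIM('a) + s * p"
  \<comment> \<open>Two points of \<open>B\<close> have distance below \<open>2 * R\<close>, so \<open>\<kappa>\<close> is nonnegative even at twice their distance.\<close>
  define b where "b = 1 / (4 * R) powr q"
  define \<theta> :: real where "\<theta> = 2 powr (p * (1 - s))"
  define A :: real where "A = 2 powr (p + DIM('a))"
  have q: "0 < q" using p s by (simp add: q_def add_pos_pos)
  have b: "0 < b" using R by (simp add: b_def)
  have \<theta>: "1 < \<theta>" using p s by (simp add: \<theta>_def)
  have A: "2 \<le> A"
  proof -
    have "2 powr 1 \<le> A" unfolding A_def using p by (intro powr_mono) auto
    then show ?thesis by simp
  qed
  have A2: "A = \<theta> * 2 powr q" by (simp add: A_def \<theta>_def q_def powr_add[symmetric] algebra_simps)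
  define W where "W z = \<bar>u (fst z) - u (snd z)\<bar> powr p" for z
  define d where "d z = norm (fst z - snd z)" for z :: "'a \<times> 'a"
  have W0: "0 \<le> W z" for z by (simp add: W_def)
  have Wd: "W z = 0" if "d z = 0" for z using that by (simp add: W_def d_def)
  have d_less: "d z < 2 * R" if "z \<in> B \<times> B" for z
  proof -
    have "norm (fst z - snd z) \<le> dist x0 (fst z) + dist x0 (snd z)"
      by (metis dist_norm dist_triangle3 dist_commute)
    then show ?thesis using that by (auto simp: B_def d_def)
  qed
  define \<kappa> where "\<kappa> \<rho> = (if \<rho> = 0 then 0 else ennreal (1 / \<rho> powr q - b))" for \<rho>
  have [measurable]: "\<kappa> \<in> borel_measurable borel"
      "W \<in> borel_measurable (lborel \<Otimes>\<^sub>M lborel)" "d \<in> borel_measurable (lborel \<Otimes>\<^sub>M lborel)"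
    unfolding \<kappa>_def W_def d_def by measurable
  define J where "J F = (\<integral>\<^sup>+z\<in>B \<times> B. F z \<partial>(lborel \<Otimes>\<^sub>M lborel))" for F :: "'a \<times> 'a \<Rightarrow> ennreal"
  have J_lin: "J (\<lambda>z. ennreal c * F z + ennreal c' * G z) = ennreal c * J F + ennreal c' * J G"
    if [measurable]: "F \<in> borel_measurable (lborel \<Otimes>\<^sub>M lborel)"
      "G \<in> borel_measurable (lborel \<Otimes>\<^sub>M lborel)" for F G c c'
    unfolding J_def by (simp add: distrib_right mult.assoc nn_integral_add nn_integral_cmult)
  have J_cong: "J F = J G" if "\<And>z. z \<in> B \<times> B \<Longrightarrow> F z = G z" for F G
    unfolding J_def by (intro nn_integral_cong) (use that in \<open>auto simp: indicator_def\<close>)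
  define E' where "E' = J (\<lambda>z. ennreal (W z / d z powr q))"
  define X where "X = J (\<lambda>z. ennreal (W z) * \<kappa> (d z))"
  define X' where "X' = J (\<lambda>z. ennreal (W z) * \<kappa> (2 * d z))"
  define Y where "Y = J (\<lambda>z. ennreal (W z))"
  have E'_le: "E' \<le> gagliardo_energy s p (B \<times> UNIV) u"
    unfolding E'_def J_def gagliardo_energy_def
    by (intro nn_integral_mono) (auto simp: W_def d_def q_def indicator_def)
  have \<kappa>_small: "\<kappa> \<rho> = ennreal (1 / \<rho> powr q - b)" "b \<le> 1 / \<rho> powr q" if "0 < \<rho>" "\<rho> < 4 * R" for \<rho>
    using that q R by (auto simp: \<kappa>_def b_def intro!: frac_le powr_mono2)
  have "ennreal 1 * X + ennreal b * Y = E'"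
    unfolding X_def Y_def E'_def
  proof (subst J_lin[symmetric]; (measurable; fail)?; intro J_cong)
    fix z assume z: "z \<in> B \<times> B"
    show "ennreal 1 * (ennreal (W z) * \<kappa> (d z)) + ennreal b * ennreal (W z) = ennreal (W z / d z powr q)"
    proof (cases "d z = 0")
      case False
      then have "0 < d z" "d z < 4 * R" using d_less[OF z] R by (auto simp: d_def)
      note \<kappa> = \<kappa>_small[OF this]
      have "0 \<le> W z * (1 / d z powr q - b)" "0 \<le> b * W z" using \<kappa>(2) W0[of z] b by simp_all
      then have "ennreal (W z * (1 / d z powr q - b) + b * W z) =
          ennreal (W z * (1 / d z powr q - b)) + ennreal (b * W z)"
        by (rule ennreal_plus)
      moreover have "W z * (1 / d z powr q - b) + b * W z = W z / d z powr q"
          by (simp add: algebra_simps)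
      ultimately show ?thesis
        using W0[of z] b unfolding \<kappa>(1) by (simp add: ennreal_mult'[symmetric])
    qed (simp add: Wd)
  qed
  then have E'_eq: "E' = X + ennreal b * Y" by simp
  have "ennreal A * X' + ennreal (A * b) * Y =
      J (\<lambda>z. ennreal \<theta> * ennreal (W z / d z powr q) + ennreal 0 * 0)"
    unfolding X'_def Y_def
  proof (subst J_lin[symmetric]; (measurable; fail)?; intro J_cong)
    fix z assume z: "z \<in> B \<times> B"
    show "ennreal A * (ennreal (W z) * \<kappa> (2 * d z)) + ennreal (A * b) * ennreal (W z) =
        ennreal \<theta> * ennreal (W z / d z powr q) + ennreal 0 * 0"
    proof (cases "d z = 0")
      case False
      then have d: "0 < d z" "0 < 2 * d z" "2 * d z < 4 * R" using d_less[OF z] R by (auto simp: d_def)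
      note \<kappa> = \<kappa>_small[OF d(2,3)]
      have "A * (1 / (2 * d z) powr q) = \<theta> / d z powr q"
        using d by (simp add: A2 powr_mult)
      then have "W z * (A * (1 / (2 * d z) powr q)) = W z * (\<theta> / d z powr q)" by (rule arg_cong)
      then have "A * (W z * (1 / (2 * d z) powr q - b)) + A * b * W z = \<theta> * (W z / d z powr q)"
        by (simp add: right_diff_distrib mult_ac)
      moreover have "0 \<le> A * (W z * (1 / (2 * d z) powr q - b))" "0 \<le> A * b * W z"
        using \<kappa>(2) W0[of z] A b by simp_all
      then have "ennreal (A * (W z * (1 / (2 * d z) powr q - b)) + A * b * W z) =
          ennreal (A * (W z * (1 / (2 * d z) powr q - b))) + ennreal (A * b * W z)"
        by (rule ennreal_plus)
      ultimately show ?thesis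
        using W0[of z] b A \<theta> unfolding \<kappa>(1) by (simp add: ennreal_mult'[symmetric])
    qed (simp add: Wd)
  qed
  also have "\<dots> = ennreal \<theta> * E'"
    using J_lin[of "\<lambda>z. ennreal (W z / d z powr q)" "\<lambda>z. 0" \<theta> 0] by (simp add: E'_def)
  finally have X'_eq: "ennreal A * X' + ennreal (A * b) * Y = ennreal \<theta> * E'" .
  have J_iterated: "J (\<lambda>z. ennreal (W z) * k (d z)) =
      (\<integral>\<^sup>+x\<in>B. (\<integral>\<^sup>+y\<in>B. ennreal (\<bar>u x - u y\<bar> powr p) * k (norm (x - y)) \<partial>lborel) \<partial>lborel)"
    if [measurable]: "k \<in> borel_measurable borel" for k
    unfolding J_def W_def d_def
    using nn_integral_set_times[of "\<lambda>x y. ennreal (\<bar>u x - u y\<bar> powr p) * k (norm (x - y))" B B] by simp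
  have "X \<le> ennreal A * X'"
    using midpoint_inequality[OF p, of B u \<kappa>] J_iterated[of \<kappa>] J_iterated[of "\<lambda>\<rho>. \<kappa> (2 * \<rho>)"]
    by (simp add: X_def X'_def A_def B_def)
  \<comment> \<open>Subtracting \<open>E'\<close> from both sides requires it to be finite.\<close>
  have "Y \<le> ennreal ((\<theta> - 1) / b) * E'"
  proof (cases "E' = \<infinity>")
    case True
    then show ?thesis using \<theta> b by (simp add: ennreal_mult_top)
  next
    case False
    have "X < \<infinity>" "ennreal b * Y < \<infinity>" using False E'_eq by (auto simp: less_top)
    then have "Y < \<infinity>" using b by (auto simp: ennreal_mult_less_top)
    obtain x y where xy: "X = ennreal x" "0 \<le> x" "Y = ennreal y" "0 \<le> y"
      using \<open>X < \<infinity>\<close> \<open>Y < \<infinity>\<close> by (auto simp: less_top_ennreal)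
    have "ennreal x + ennreal (A * b) * ennreal y \<le> ennreal \<theta> * (ennreal x + ennreal b * ennreal y)"
      using \<open>X \<le> ennreal A * X'\<close> X'_eq unfolding E'_eq xy by (metis add_right_mono)
    then have "x + A * b * y \<le> \<theta> * (x + b * y)"
      using xy b \<theta> A by (simp add: ennreal_mult'[symmetric] ennreal_plus[symmetric] del: ennreal_plus)
    moreover have "2 * (b * y) \<le> A * (b * y)"
      using A b xy by (intro mult_right_mono) auto
    ultimately have "b * y \<le> (\<theta> - 1) * (x + b * y)" by (simp add: algebra_simps)
    then have "y \<le> (\<theta> - 1) / b * (x + b * y)" using b by (simp add: field_simps)
    then show ?thesis using xy b \<theta>
      by (simp add: E'_eq ennreal_mult'[symmetric] ennreal_plus[symmetric] del: ennreal_plus)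
  qed
  also have "\<dots> \<le> ennreal ((\<theta> - 1) / b) * gagliardo_energy s p (B \<times> UNIV) u"
    by (intro mult_left_mono E'_le) simp
  finally show ?thesis
    by (simp add: Y_def J_def W_def oscillation_def B_def b_def \<theta>_def q_def mult.commute)
qed

text \<open>
For \<open>x\<close> and \<open>x'\<close> in \<open>B\<close> and \<open>y = x0 + h\<close> with \<open>norm h \<ge> 2 * R\<close>, go from \<open>u x\<close> to \<open>u x'\<close> through
\<open>u y\<close>. Since \<open>norm (x - y) \<le> 2 * norm h\<close>, and likewise for \<open>x'\<close>, multiplying by
\<open>1 / norm h powr q\<close> and integrating over \<open>h\<close>, \<open>x\<close> and \<open>x'\<close> turns the right-hand side into a
multiple of the energy.
\<close>
lemma oscillation_le_far:
  fixes u :: "'a::euclidean_space \<Rightarrow> real"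
  assumes p: "1 \<le> p" and s: "0 < s" "s < 1" and R: "0 < R"
    and [measurable]: "u \<in> borel_measurable borel"
  shows "tail_integral TYPE('a) s p (2 * R) * oscillation p (ball x0 R) u \<le>
    ennreal (2 powr (p + (real DIM('a) + s * p))) * emeasure lborel (ball x0 R) *
      gagliardo_energy s p (ball x0 R \<times> UNIV) u"
proof -
  define B where "B = ball x0 R"
  have [measurable]: "B \<in> sets borel" by (simp add: B_def)
  define q where "q = real DIM('a) + s * p"
  have q: "0 < q" using p s by (simp add: q_def add_pos_pos)
  define T where "T = tail_integral TYPE('a) s p (2 * R)"
  define C :: real where "C = 2 powr (p - 1) * 2 powr q"
  define \<Phi> where "\<Phi> x = (\<integral>\<^sup>+y. ennreal (\<bar>u x - u y\<bar> powr p / norm (x - y) powr q) \<partial>lborel)" for x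
  have [measurable]: "\<Phi> \<in> borel_measurable borel" unfolding \<Phi>_def by measurable
  have \<Phi>_shift: "\<Phi> x = (\<integral>\<^sup>+h. ennreal (\<bar>u x - u (x0 + h)\<bar> powr p / norm (x - (x0 + h)) powr q) \<partial>lborel)"
      for x
    unfolding \<Phi>_def by (subst nn_integral_lborel_affine[where c = 1 and t = x0]) simp_all
  have E: "gagliardo_energy s p (B \<times> UNIV) u = (\<integral>\<^sup>+x\<in>B. \<Phi> x \<partial>lborel)"
    by (subst gagliardo_energy_iterated) (simp_all add: \<Phi>_def q_def)
  have pair: "T * ennreal (\<bar>u x - u x'\<bar> powr p) \<le> ennreal C * (\<Phi> x + \<Phi> x')" if x: "x \<in> B" "x' \<in> B"
      for x x'
  proof -
    have near: "1 / norm h powr q \<le> 2 powr q / norm (x - (x0 + h)) powr q"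
      if "x \<in> B" "2 * R \<le> norm h" for x h
    proof -
      have "norm (x - x0) < R" using that by (simp add: B_def dist_norm norm_minus_commute)
      moreover have "x - (x0 + h) = (x - x0) - h" by simp
      ultimately have "norm (x - (x0 + h)) \<le> 2 * norm h" "0 < norm (x - (x0 + h))"
        using norm_triangle_ineq4[of "x - x0" h] norm_triangle_ineq2[of h "x - x0"]
          norm_minus_commute[of h "x - x0"] that(2) R
        by (simp_all only:)
      then have "norm (x - (x0 + h)) powr q \<le> 2 powr q * norm h powr q" "0 < norm (x - (x0 + h)) powr q"
        using q by (auto simp: powr_mult[symmetric] intro!: powr_mono2)
      moreover have "0 < norm h powr q" using that R by auto
      ultimately show ?thesis by (simp add: divide_simps)
    qed
    have "T * ennreal (\<bar>u x - u x'\<bar> powr p) =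
        (\<integral>\<^sup>+h. ennreal (of_bool (2 * R \<le> norm (h::'a)) / norm h powr q)
            * ennreal (\<bar>u x - u x'\<bar> powr p) \<partial>lborel)"
      by (simp add: nn_integral_multc T_def tail_integral_def q_def)
    also have "\<dots> \<le> (\<integral>\<^sup>+h. ennreal C * (ennreal (\<bar>u x - u (x0 + h)\<bar> powr p / norm (x - (x0 + h)) powr q)
        + ennreal (\<bar>u x' - u (x0 + h)\<bar> powr p / norm (x' - (x0 + h)) powr q)) \<partial>lborel)"
    proof (intro nn_integral_mono)
      fix h :: 'a
      show "ennreal (of_bool (2 * R \<le> norm h) / norm h powr q) * ennreal (\<bar>u x - u x'\<bar> powr p)
        \<le> ennreal C * (ennreal (\<bar>u x - u (x0 + h)\<bar> powr p / norm (x - (x0 + h)) powr q)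
        + ennreal (\<bar>u x' - u (x0 + h)\<bar> powr p / norm (x' - (x0 + h)) powr q))"
      proof (cases "2 * R \<le> norm h")
        case True
        let ?a = "\<bar>u x - u (x0 + h)\<bar> powr p" and ?b = "\<bar>u x' - u (x0 + h)\<bar> powr p"
        have "1 / norm h powr q * \<bar>u x - u x'\<bar> powr p \<le> 1 / norm h powr q * (2 powr (p - 1) * (?a + ?b))"
          using powr_abs_diff_le[OF p, of "u x" "u x'" "u (x0 + h)"]
          by (intro mult_left_mono) (auto simp: abs_minus_commute)
        also have "\<dots> = 2 powr (p - 1) * (?a * (1 / norm h powr q) + ?b * (1 / norm h powr q))"
          by (simp add: add_divide_distrib[symmetric])
        also have "\<dots> \<le> 2 powr (p - 1)
            * (?a * (2 powr q / norm (x - (x0 + h)) powr q)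
                + ?b * (2 powr q / norm (x' - (x0 + h)) powr q))"
          using near[OF x(1) True] near[OF x(2) True] by (intro mult_left_mono add_mono) auto
        also have "\<dots> = C * (?a / norm (x - (x0 + h)) powr q + ?b / norm (x' - (x0 + h)) powr q)"
          by (simp add: C_def algebra_simps)
        finally show ?thesis using True
          by (simp add: C_def ennreal_mult'[symmetric] ennreal_plus[symmetric] del: ennreal_plus)
      qed simp
    qed
    also have "\<dots> = ennreal C * (\<Phi> x + \<Phi> x')"
      by (simp add: \<Phi>_shift nn_integral_cmult nn_integral_add)
    finally show ?thesis .
  qed
  have "T * oscillation p B u =
      (\<integral>\<^sup>+z\<in>B \<times> B. T * ennreal (\<bar>u (fst z) - u (snd z)\<bar> powr p) \<partial>(lborel \<Otimes>\<^sub>M lborel))"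
    unfolding oscillation_def by (subst nn_integral_cmult[symmetric]) (simp_all add: mult.assoc)
  also have "\<dots> \<le> (\<integral>\<^sup>+z\<in>B \<times> B. ennreal C * (\<Phi> (fst z) + \<Phi> (snd z)) \<partial>(lborel \<Otimes>\<^sub>M lborel))"
    by (intro nn_integral_mono) (use pair in \<open>auto simp: indicator_def\<close>)
  also have "\<dots> = (\<integral>\<^sup>+x\<in>B. (\<integral>\<^sup>+y\<in>B. ennreal C * (\<Phi> x + \<Phi> y) \<partial>lborel) \<partial>lborel)"
    by (rule nn_integral_set_times) measurable
  also have "\<dots> = (\<integral>\<^sup>+x\<in>B. ennreal C * (\<Phi> x * emeasure lborel B + (\<integral>\<^sup>+y\<in>B. \<Phi> y \<partial>lborel)) \<partial>lborel)"
    by (simp add: mult.assoc distrib_right nn_integral_cmult nn_integral_add)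
  also have "\<dots> = (\<integral>\<^sup>+x. ennreal C
      * (\<Phi> x * indicator B x * emeasure lborel B + (\<integral>\<^sup>+y\<in>B. \<Phi> y \<partial>lborel) * indicator B x) \<partial>lborel)"
    by (intro nn_integral_cong) (auto simp: indicator_def)
  also have "\<dots> = ennreal C * ((\<integral>\<^sup>+x\<in>B. \<Phi> x \<partial>lborel) * emeasure lborel B
      + (\<integral>\<^sup>+y\<in>B. \<Phi> y \<partial>lborel) * emeasure lborel B)"
    by (simp add: nn_integral_cmult nn_integral_add nn_integral_multc)
  also have "\<dots> = ennreal (2 * C) * emeasure lborel B * (\<integral>\<^sup>+x\<in>B. \<Phi> x \<partial>lborel)"
  proof -
    have "ennreal (2 * C) = ennreal C + ennreal C"
      unfolding mult_2 by (rule ennreal_plus) (simp_all add: C_def)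
    then show ?thesis by (simp add: distrib_left distrib_right mult_ac)
  qed
  also have "2 * C = 2 powr (p + q)" by (simp add: C_def powr_add powr_diff)
  also have "(\<integral>\<^sup>+x\<in>B. \<Phi> x \<partial>lborel) = gagliardo_energy s p (B \<times> UNIV) u"
    by (rule E[symmetric])
  finally show ?thesis
    by (simp add: T_def B_def q_def)
qed

section \<open>Testing the capacity\<close>

lemma gagliardo_energy_affine:
  fixes u :: "'a::euclidean_space \<Rightarrow> real"
  assumes [measurable]: "u \<in> borel_measurable borel" "Z \<in> sets (borel \<Otimes>\<^sub>M borel)"
  shows "gagliardo_energy s p Z (\<lambda>x. a + b * u x) = ennreal (\<bar>b\<bar> powr p) * gagliardo_energy s p Z u"
proof -
  have "\<bar>a + b * u x - (a + b * u y)\<bar> powr p = \<bar>b\<bar> powr p * \<bar>u x - u y\<bar> powr p" for x y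
    by (simp add: powr_mult[symmetric] abs_mult[symmetric] right_diff_distrib)
  then show ?thesis
    unfolding gagliardo_energy_def
    by (subst nn_integral_cmult[symmetric])
       (auto simp: ennreal_mult'[symmetric] mult.assoc[symmetric] split_beta intro!: nn_integral_cong)
qed

text \<open>
A function \<open>\<eta>\<close> with values in \<open>{0..1}\<close> and Lipschitz constant \<open>1 / \<delta>\<close> has
\<open>\<bar>\<eta> x - \<eta> y\<bar> \<le> min 1 (norm (x - y) / \<delta>)\<close>. So this number bounds, for every \<open>x\<close>, the integral over
\<open>y\<close> of \<open>\<bar>\<eta> x - \<eta> y\<bar> powr p / norm (x - y) powr q\<close>.
\<close>
definition lipschitz_kernel_mass :: "'a::euclidean_space itself \<Rightarrow> real \<Rightarrow> real \<Rightarrow> real \<Rightarrow> ennreal" where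
  "lipschitz_kernel_mass T s p \<delta> =
    (\<integral>\<^sup>+h. ennreal (min 1 (norm (h::'a) / \<delta>) powr p / norm h powr (real DIM('a) + s * p)) \<partial>lborel)"

text \<open>
The product \<open>\<eta> * w\<close> contributes nothing when both points lie outside \<open>B\<close>, so by symmetry twice the
part with \<open>x\<close> in \<open>B\<close> suffices. There the Leibniz rule
\<open>\<eta> x * w x - \<eta> y * w y = \<eta> y * (w x - w y) + w x * (\<eta> x - \<eta> y)\<close> is used in the order that
evaluates the undifferenced \<open>w\<close> at \<open>x\<close>; this keeps the second term an integral of \<open>\<bar>w\<bar> powr p\<close>
over \<open>B\<close> alone.
\<close>
lemma gagliardo_energy_cutoff_mult:
  fixes w \<eta> :: "'a::euclidean_space \<Rightarrow> real"
  assumes p: "1 \<le> p"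
    and [measurable]: "w \<in> borel_measurable borel" "\<eta> \<in> borel_measurable borel" "B \<in> sets borel"
    and \<eta>: "\<And>x. 0 \<le> \<eta> x" "\<And>x. \<eta> x \<le> 1" "\<And>x y. \<bar>\<eta> x - \<eta> y\<bar> \<le> norm (x - y) / \<delta>"
    and supp: "\<And>x. x \<notin> B \<Longrightarrow> \<eta> x = 0"
  shows "gagliardo_energy s p UNIV (\<lambda>x. \<eta> x * w x) \<le> ennreal (2 powr p) *
    (gagliardo_energy s p (B \<times> UNIV) w
      + lipschitz_kernel_mass TYPE('a) s p \<delta> * (\<integral>\<^sup>+x\<in>B. ennreal (\<bar>w x\<bar> powr p) \<partial>lborel))"
proof -
  define q where "q = real DIM('a) + s * p"
  define K where "K = lipschitz_kernel_mass TYPE('a) s p \<delta>"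
  define G where "G x y = ennreal (\<bar>\<eta> x * w x - \<eta> y * w y\<bar> powr p / norm (x - y) powr q)" for x y
  define \<Phi> where "\<Phi> x = (\<integral>\<^sup>+y. ennreal (\<bar>w x - w y\<bar> powr p / norm (x - y) powr q) \<partial>lborel)" for x
  have [measurable]: "case_prod G \<in> borel_measurable (lborel \<Otimes>\<^sub>M lborel)" "\<Phi> \<in> borel_measurable borel"
    unfolding G_def \<Phi>_def by measurable
  have inner: "(\<integral>\<^sup>+y. G x y \<partial>lborel) \<le> ennreal (2 powr (p - 1)) * (\<Phi> x + ennreal (\<bar>w x\<bar> powr p) * K)"
      for x
  proof -
    have "(\<integral>\<^sup>+y. G x y \<partial>lborel) \<le>
        (\<integral>\<^sup>+y. ennreal (2 powr (p - 1)) * (ennreal (\<bar>w x - w y\<bar> powr p / norm (x - y) powr q)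
        + ennreal (\<bar>w x\<bar> powr p) * ennreal (min 1 (norm (x - y) / \<delta>) powr p
            / norm (x - y) powr q)) \<partial>lborel)"
    proof (intro nn_integral_mono)
      fix y
      have "\<eta> x * w x - \<eta> y * w y = \<eta> y * (w x - w y) + w x * (\<eta> x - \<eta> y)" by (simp add: algebra_simps)
      then have "\<bar>\<eta> x * w x - \<eta> y * w y\<bar> powr p \<le>
          2 powr (p - 1) * (\<bar>\<eta> y * (w x - w y)\<bar> powr p + \<bar>w x * (\<eta> x - \<eta> y)\<bar> powr p)"
        using powr_abs_add_le[OF p] by simp
      also have "\<dots> \<le> 2 powr (p - 1)
          * (\<bar>w x - w y\<bar> powr p + \<bar>w x\<bar> powr p * min 1 (norm (x - y) / \<delta>) powr p)"
      proof (intro mult_left_mono add_mono)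
        show "\<bar>\<eta> y * (w x - w y)\<bar> powr p \<le> \<bar>w x - w y\<bar> powr p"
          using p \<eta>(1,2)[of y] by (intro powr_mono2) (auto simp: abs_mult intro: mult_left_le_one_le)
        have "\<bar>\<eta> x - \<eta> y\<bar> \<le> min 1 (norm (x - y) / \<delta>)"
          using \<eta>(1,2)[of x] \<eta>(1,2)[of y] \<eta>(3)[of x y] by auto
        then show "\<bar>w x * (\<eta> x - \<eta> y)\<bar> powr p \<le> \<bar>w x\<bar> powr p * min 1 (norm (x - y) / \<delta>) powr p"
          using p by (auto simp: abs_mult powr_mult intro!: mult_left_mono powr_mono2)
      qed simp
      finally have "\<bar>\<eta> x * w x - \<eta> y * w y\<bar> powr p / norm (x - y) powr q \<le>
          2 powr (p - 1) * (\<bar>w x - w y\<bar> powr p + \<bar>w x\<bar> powr p * min 1 (norm (x - y) / \<delta>) powr p)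
              / norm (x - y) powr q"
        by (rule divide_right_mono) simp
      also have "\<dots> = 2 powr (p - 1)
          * (\<bar>w x - w y\<bar> powr p / norm (x - y) powr q
              + \<bar>w x\<bar> powr p * (min 1 (norm (x - y) / \<delta>) powr p / norm (x - y) powr q))"
        by (simp add: add_divide_distrib[symmetric])
      finally have "G x y \<le> ennreal \<dots>" unfolding G_def by (rule ennreal_leI)
      then show "G x y \<le> ennreal (2 powr (p - 1)) * (ennreal (\<bar>w x - w y\<bar> powr p / norm (x - y) powr q)
        + ennreal (\<bar>w x\<bar> powr p) * ennreal (min 1 (norm (x - y) / \<delta>) powr p / norm (x - y) powr q))"
        by (simp add: ennreal_mult'[symmetric] ennreal_plus[symmetric] del: ennreal_plus)
    qed
    also have "\<dots> = ennreal (2 powr (p - 1))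
        * (\<Phi> x + ennreal (\<bar>w x\<bar> powr p)
            * (\<integral>\<^sup>+y. ennreal (min 1 (norm (x - y) / \<delta>) powr p / norm (x - y) powr q) \<partial>lborel))"
      unfolding \<Phi>_def by (simp add: nn_integral_cmult nn_integral_add)
    also have "(\<integral>\<^sup>+y. ennreal (min 1 (norm (x - y) / \<delta>) powr p / norm (x - y) powr q) \<partial>lborel) = K"
      unfolding K_def lipschitz_kernel_mass_def q_def
      by (subst nn_integral_lborel_affine[where c = 1 and t = x]) simp_all
    finally show ?thesis .
  qed
  have "gagliardo_energy s p UNIV (\<lambda>x. \<eta> x * w x) = (\<integral>\<^sup>+x. \<integral>\<^sup>+y. G x y \<partial>lborel \<partial>lborel)"
    using gagliardo_energy_iterated[of "\<lambda>x. \<eta> x * w x" UNIV s p] by (simp add: G_def q_def)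
  also have "\<dots> \<le> (\<integral>\<^sup>+x. \<integral>\<^sup>+y. G x y * indicator B x + G y x * indicator B y \<partial>lborel \<partial>lborel)"
    by (intro nn_integral_mono)
      (use supp in \<open>auto simp: G_def indicator_def norm_minus_commute abs_minus_commute\<close>)
  also have "\<dots> = (\<integral>\<^sup>+x. \<integral>\<^sup>+y. G x y * indicator B x \<partial>lborel \<partial>lborel)
      + (\<integral>\<^sup>+x. \<integral>\<^sup>+y. G y x * indicator B y \<partial>lborel \<partial>lborel)"
    by (simp add: nn_integral_add)
  also have "(\<integral>\<^sup>+x. \<integral>\<^sup>+y. G y x * indicator B y \<partial>lborel \<partial>lborel) =
      (\<integral>\<^sup>+x. \<integral>\<^sup>+y. G x y * indicator B x \<partial>lborel \<partial>lborel)"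
    by (rule lborel_pair.Fubini') measurable
  also have "(\<integral>\<^sup>+x. \<integral>\<^sup>+y. G x y * indicator B x \<partial>lborel \<partial>lborel)
      + (\<integral>\<^sup>+x. \<integral>\<^sup>+y. G x y * indicator B x \<partial>lborel \<partial>lborel)
      = 2 * (\<integral>\<^sup>+x\<in>B. (\<integral>\<^sup>+y. G x y \<partial>lborel) \<partial>lborel)"
    by (simp add: mult_2 nn_integral_multc)
  also have "\<dots> \<le> 2 * (\<integral>\<^sup>+x. ennreal (2 powr (p - 1))
      * (\<Phi> x * indicator B x + ennreal (\<bar>w x\<bar> powr p) * indicator B x * K) \<partial>lborel)"
    by (intro mult_left_mono nn_integral_mono) (use inner in \<open>auto simp: indicator_def\<close>)
  also have "\<dots> = 2 * (ennreal (2 powr (p - 1))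
      * ((\<integral>\<^sup>+x\<in>B. \<Phi> x \<partial>lborel) + (\<integral>\<^sup>+x\<in>B. ennreal (\<bar>w x\<bar> powr p) \<partial>lborel) * K))"
    by (simp add: nn_integral_cmult nn_integral_add nn_integral_multc)
  also have "(\<integral>\<^sup>+x\<in>B. \<Phi> x \<partial>lborel) = gagliardo_energy s p (B \<times> UNIV) w"
    by (subst gagliardo_energy_iterated) (simp_all add: \<Phi>_def q_def)
  also have "2 * (ennreal (2 powr (p - 1)) * X) = ennreal (2 powr p) * X" for X
  proof -
    have "ennreal (2 powr p) = 2 * ennreal (2 powr (p - 1))"
      by (simp add: powr_diff ennreal_mult'[symmetric] flip: ennreal_numeral)
    then show ?thesis by (simp add: mult.assoc)
  qed
  finally show ?thesis by (simp add: K_def mult.commute)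
qed

text \<open>
Test the capacity with \<open>\<eta> * (1 - u / c)\<close> and rescale by \<open>\<bar>c\<bar> powr p\<close>.
\<close>
lemma rel_cap_test_inequality:
  fixes u \<eta> :: "'a::euclidean_space \<Rightarrow> real"
  assumes p: "1 \<le> p" and u: "smooth u" "\<And>x. x \<in> \<Sigma> \<Longrightarrow> u x = 0"
    and \<eta>: "\<eta> \<in> test_functions (ball x0 R)" "\<And>x. x \<in> \<Sigma> \<Longrightarrow> \<eta> x = 1" "\<And>x. 0 \<le> \<eta> x" "\<And>x. \<eta> x \<le> 1"
      "\<And>x y. \<bar>\<eta> x - \<eta> y\<bar> \<le> norm (x - y) / \<delta>"
  shows "ennreal (\<bar>c\<bar> powr p) * rel_cap s p \<Sigma> (ball x0 R) \<le> ennreal (2 powr p) *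
    (gagliardo_energy s p (ball x0 R \<times> UNIV) u
      + lipschitz_kernel_mass TYPE('a) s p \<delta> * (\<integral>\<^sup>+x\<in>ball x0 R. ennreal (\<bar>u x - c\<bar> powr p) \<partial>lborel))"
proof (cases "c = 0")
  case False
  define K where "K = lipschitz_kernel_mass TYPE('a) s p \<delta>"
  define b where "b = ennreal (\<bar>- inverse c\<bar> powr p)"
  define w where "w x = 1 + (- inverse c) * u x" for x
  have [measurable]: "ball x0 R \<in> sets borel" by simp
  have [measurable]: "u \<in> borel_measurable borel" "\<eta> \<in> borel_measurable borel"
    using smooth_continuous[OF u(1)] test_function_continuous[OF \<eta>(1)]
    by (auto intro: borel_measurable_continuous_onI)
  then have [measurable]: "w \<in> borel_measurable borel" unfolding w_def by measurable
  have cb: "ennreal (\<bar>c\<bar> powr p) * b = 1"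
    using False by (simp add: b_def ennreal_mult'[symmetric] powr_mult[symmetric] abs_mult[symmetric])
  have "smooth w"
    unfolding w_def by (intro smooth_add smooth_mult smooth_const u)
  then have "(\<lambda>x. \<eta> x * w x) \<in> test_functions (ball x0 R)"
    by (rule test_functions_mult[OF \<eta>(1)])
  then have "rel_cap s p \<Sigma> (ball x0 R) \<le> gagliardo_energy s p UNIV (\<lambda>x. \<eta> x * w x)"
    unfolding rel_cap_def by (intro INF_lower) (auto simp: \<eta>(2) w_def u(2))
  also have "\<dots> \<le> ennreal (2 powr p)
      * (gagliardo_energy s p (ball x0 R \<times> UNIV) w
          + K * (\<integral>\<^sup>+x\<in>ball x0 R. ennreal (\<bar>w x\<bar> powr p) \<partial>lborel))"
    unfolding K_def
  proof (rule gagliardo_energy_cutoff_mult[OF p _ _ _ \<eta>(3-5)])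
    show "\<eta> x = 0" if "x \<notin> ball x0 R" for x
      using that \<eta>(1) closure_subset[of "{x. \<eta> x \<noteq> 0}"] by (auto simp: test_functions_def)
  qed simp_all
  also have "gagliardo_energy s p (ball x0 R \<times> UNIV) w = b * gagliardo_energy s p (ball x0 R \<times> UNIV) u"
    unfolding w_def b_def by (rule gagliardo_energy_affine) simp_all
  also have "(\<integral>\<^sup>+x\<in>ball x0 R. ennreal (\<bar>w x\<bar> powr p) \<partial>lborel) =
      b * (\<integral>\<^sup>+x\<in>ball x0 R. ennreal (\<bar>u x - c\<bar> powr p) \<partial>lborel)"
  proof -
    have "\<bar>w x\<bar> powr p = \<bar>- inverse c\<bar> powr p * \<bar>u x - c\<bar> powr p" for x
    proof -
      have "w x = - inverse c * (u x - c)" using False by (simp add: w_def algebra_simps)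
      then show ?thesis by (simp add: powr_mult abs_mult)
    qed
    then show ?thesis
      unfolding b_def by (subst nn_integral_cmult[symmetric]) (simp_all add: ennreal_mult' mult.assoc)
  qed
  finally have "ennreal (\<bar>c\<bar> powr p) * rel_cap s p \<Sigma> (ball x0 R) \<le>
      ennreal (\<bar>c\<bar> powr p) * (ennreal (2 powr p) *
     (b * gagliardo_energy s p (ball x0 R \<times> UNIV) u
         + K * (b * (\<integral>\<^sup>+x\<in>ball x0 R. ennreal (\<bar>u x - c\<bar> powr p) \<partial>lborel))))"
    by (rule mult_left_mono) simp
  also have "\<dots> = (ennreal (\<bar>c\<bar> powr p) * b) * (ennreal (2 powr p) *
     (gagliardo_energy s p (ball x0 R \<times> UNIV) u
         + K * (\<integral>\<^sup>+x\<in>ball x0 R. ennreal (\<bar>u x - c\<bar> powr p) \<partial>lborel)))"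
    by (simp add: distrib_left mult_ac)
  finally show ?thesis by (simp add: cb K_def)
qed simp

text \<open>
The near bound on the oscillation is matched with the core of the kernel mass, the far bound with
its tail; in each product the dependence on \<open>s\<close> that degenerates at an end of \<open>{0<..<1}\<close> cancels.
\<close>
lemma kernel_mass_times_oscillation:
  fixes u :: "'a::euclidean_space \<Rightarrow> real" and p :: real
  assumes p: "1 \<le> p" and s: "0 < s" "s < 1" and \<delta>: "0 < \<delta>" "\<delta> \<le> R"
    and [measurable]: "u \<in> borel_measurable borel"
  shows "lipschitz_kernel_mass TYPE('a) s p \<delta> * oscillation p (ball x0 R) u \<le>
    ennreal (2 * 8 powr (real DIM('a) + p) * unit_ball_vol (real DIM('a)) * R ^ DIM('a)
        * (R / \<delta>) powr p) *
      gagliardo_energy s p (ball x0 R \<times> UNIV) u"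
proof -
  define N where "N = real DIM('a)"
  define \<omega> where "\<omega> = unit_ball_vol N"
  define E where "E = gagliardo_energy s p (ball x0 R \<times> UNIV) u"
  define Y where "Y = oscillation p (ball x0 R) u"
  define \<theta> :: real where "\<theta> = 2 powr (p * (1 - s))"
  have R: "0 < R" using \<delta> by simp
  have N: "0 \<le> N" "0 \<le> \<omega>" by (simp_all add: N_def \<omega>_def)
  have RN: "R ^ DIM('a) = R powr N" using R by (simp add: N_def powr_realpow)
  have sp: "0 \<le> s * p" "s * p \<le> p" using p s by (auto simp: mult_left_le_one_le)
  have \<theta>: "1 < \<theta>" using p s by (simp add: \<theta>_def)
  have ratio: "(R / \<delta>) powr (s * p) \<le> (R / \<delta>) powr p" using \<delta> sp by (intro powr_mono) auto
  have core: "core_integral TYPE('a) s p * Y \<le>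
      ennreal ((4 * R) powr (N + s * p) * (2 powr p * 2 ^ DIM('a) * \<omega>)) * E"
  proof -
    have "core_integral TYPE('a) s p * Y \<le>
        core_integral TYPE('a) s p * (ennreal ((4 * R) powr (N + s * p) * (\<theta> - 1)) * E)"
      unfolding Y_def E_def N_def \<theta>_def by (intro mult_left_mono oscillation_le_near) (use assms R in auto)
    also have "\<dots> = ennreal ((4 * R) powr (N + s * p)) * (ennreal (\<theta> - 1) * core_integral TYPE('a) s p)
        * E"
      using \<theta> by (simp add: ennreal_mult' mult_ac)
    also have "\<dots> \<le> ennreal ((4 * R) powr (N + s * p)) * ennreal (2 powr p * 2 ^ DIM('a) * \<omega>) * E"
      unfolding \<theta>_def \<omega>_def N_def by (intro mult_left_mono mult_right_mono core_integral_bound)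
        (use p s in auto)
    finally show ?thesis by (simp add: ennreal_mult')
  qed
  have tail: "tail_integral TYPE('a) s p 1 * Y \<le>
      ennreal ((2 * R) powr (s * p) * (2 powr (p + (N + s * p)) * (\<omega> * R powr N))) * E"
  proof -
    have "tail_integral TYPE('a) s p 1 * Y =
        ennreal ((2 * R) powr (s * p)) * (tail_integral TYPE('a) s p (2 * R) * Y)"
      using tail_integral_scaling[of 1 "2 * R", where 'a = 'a] R by (simp add: mult.assoc)
    also have "\<dots> \<le> ennreal ((2 * R) powr (s * p))
        * (ennreal (2 powr (p + (N + s * p))) * emeasure lborel (ball x0 R) * E)"
      unfolding Y_def E_def N_def by (intro mult_left_mono oscillation_le_far) (use assms R in auto)
    also have "\<dots> = ennreal ((2 * R) powr (s * p) * (2 powr (p + (N + s * p)) * (\<omega> * R powr N))) * E"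
      using R by (simp add: emeasure_ball ennreal_mult' \<omega>_def N_def powr_realpow mult.assoc)
    finally show ?thesis .
  qed
  have core_const: "\<delta> powr - (s * p) * ((4 * R) powr (N + s * p) * (2 powr p * 2 ^ DIM('a) * \<omega>))
      \<le> 8 powr (N + p) * \<omega> * R powr N * (R / \<delta>) powr p"
  proof -
    have "\<delta> powr - (s * p) * ((4 * R) powr (N + s * p) * (2 powr p * 2 ^ DIM('a) * \<omega>)) =
        (4 powr (N + s * p) * 2 powr (N + p)) * \<omega> * R powr N * (R / \<delta>) powr (s * p)"
      using R \<delta> by (simp add: powr_mult powr_add powr_minus_divide powr_divide N_def powr_realpow)
    also have "\<dots> \<le> (4 powr (N + p) * 2 powr (N + p)) * \<omega> * R powr N * (R / \<delta>) powr p"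
    proof (intro mult_mono ratio)
      show "4 powr (N + s * p) \<le> (4::real) powr (N + p)" using sp by (intro powr_mono) auto
    qed (use N in auto)
    also have "(4::real) powr (N + p) * 2 powr (N + p) = 8 powr (N + p)"
      by (simp add: powr_mult[symmetric])
    finally show ?thesis .
  qed
  have tail_const: "\<delta> powr - (s * p)
      * ((2 * R) powr (s * p) * (2 powr (p + (N + s * p)) * (\<omega> * R powr N)))
      \<le> 8 powr (N + p) * \<omega> * R powr N * (R / \<delta>) powr p"
  proof -
    have "\<delta> powr - (s * p) * ((2 * R) powr (s * p) * (2 powr (p + (N + s * p)) * (\<omega> * R powr N))) =
        (2 powr (s * p + (p + (N + s * p)))) * \<omega> * R powr N * (R / \<delta>) powr (s * p)"
      using R \<delta> by (subst powr_add[of 2 "s * p"]) (simp add: powr_mult powr_minus_divide powr_divide)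
    also have "\<dots> \<le> 2 powr (3 * (N + p)) * \<omega> * R powr N * (R / \<delta>) powr p"
    proof (intro mult_mono ratio)
      have "a + (p + (N + a)) \<le> 3 * (N + p)" if "a \<le> p" for a using that N by simp
      from this[OF sp(2)] have "s * p + (p + (N + s * p)) \<le> 3 * (N + p)" .
      then show "2 powr (s * p + (p + (N + s * p))) \<le> (2::real) powr (3 * (N + p))"
          by (intro powr_mono) auto
    qed (use N in auto)
    also have "(2::real) powr (3 * (N + p)) = 8 powr (N + p)"
      by (subst powr_powr[symmetric]) simp
    finally show ?thesis .
  qed
  have "lipschitz_kernel_mass TYPE('a) s p \<delta> * Y
      = ennreal (\<delta> powr - (s * p)) * (core_integral TYPE('a) s p * Y + tail_integral TYPE('a) s p 1 * Y)"
    unfolding lipschitz_kernel_mass_def using truncated_kernel_integral[OF \<delta>(1), of p s, where 'a = 'a]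
    by (simp add: distrib_right mult.assoc)
  also have "\<dots> \<le> ennreal (\<delta> powr - (s * p))
      * (ennreal ((4 * R) powr (N + s * p) * (2 powr p * 2 ^ DIM('a) * \<omega>)) * E
      + ennreal ((2 * R) powr (s * p) * (2 powr (p + (N + s * p)) * (\<omega> * R powr N))) * E)"
    by (intro mult_left_mono add_mono core tail) simp
  also have "\<dots> = (ennreal (\<delta> powr - (s * p) * ((4 * R) powr (N + s * p) * (2 powr p * 2 ^ DIM('a) * \<omega>)))
      + ennreal (\<delta> powr - (s * p)
          * ((2 * R) powr (s * p) * (2 powr (p + (N + s * p)) * (\<omega> * R powr N))))) * E"
    by (simp only: ennreal_mult'[OF powr_ge_zero] distrib_left distrib_right mult.assoc)
  also have "\<dots> \<le> (ennreal (8 powr (N + p) * \<omega> * R powr N * (R / \<delta>) powr p)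
      + ennreal (8 powr (N + p) * \<omega> * R powr N * (R / \<delta>) powr p)) * E"
    by (intro mult_right_mono add_mono ennreal_leI core_const tail_const) simp
  also have "\<dots> = ennreal (2 * 8 powr (N + p) * \<omega> * R powr N * (R / \<delta>) powr p) * E"
    using N by (simp add: ennreal_plus[symmetric] mult_ac del: ennreal_plus)
  finally show ?thesis by (simp add: Y_def E_def N_def \<omega>_def RN)
qed

section \<open>The inequality for capacity and integral\<close>

text \<open>
The power-\<open>p\<close> form of the inequality. For every \<open>y\<close> in \<open>B\<close> the bound \<open>pointwise\<close> below holds with
\<open>c = u y\<close>; integrating it over \<open>y\<close> and cancelling the volume \<open>m\<close> of \<open>B\<close> leaves the product of
kernel mass and oscillation.
\<close>
lemma rel_cap_mult_integral_le:
  fixes p :: real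
  assumes p: "1 \<le> p"
  shows "\<exists>C>0. \<forall>s (x0::'a::euclidean_space) r R \<Sigma> u. 0 < s \<longrightarrow> s < 1 \<longrightarrow> 0 < r \<longrightarrow> r < R \<longrightarrow>
      \<Sigma> \<subseteq> cball x0 r \<longrightarrow> smooth u \<longrightarrow> (\<forall>x\<in>\<Sigma>. u x = 0) \<longrightarrow>
      rel_cap s p \<Sigma> (ball x0 R) * (\<integral>\<^sup>+x\<in>ball x0 r. ennreal (\<bar>u x\<bar> powr p) \<partial>lborel)
        \<le> ennreal (C * R powr DIM('a) * (R / (R - r)) powr p)
            * gagliardo_energy s p (ball x0 R \<times> UNIV) u"
proof -
  obtain L :: real where L: "1 \<le> L" and cutoff:
    "\<And>(x0::'a::euclidean_space) r R. 0 < r \<Longrightarrow> r < R \<Longrightarrow>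
      \<exists>\<eta> \<in> test_functions (ball x0 R). (\<forall>x\<in>cball x0 r. \<eta> x = 1) \<and> (\<forall>x. 0 \<le> \<eta> x \<and> \<eta> x \<le> 1)
        \<and> (\<forall>x y. \<bar>\<eta> x - \<eta> y\<bar> \<le> L / (R - r) * norm (x - y))"
    using cutoff_exists[where 'a = 'a] by blast
  define N where "N = real DIM('a)"
  define \<omega> where "\<omega> = unit_ball_vol N"
  have \<omega>: "0 < \<omega>" by (simp add: \<omega>_def N_def)
  define C0 where "C0 = 4 * 8 powr (N + p)"
  define C where "C = 4 powr p * (1 + C0) * \<omega> * L powr p"
  have C: "0 < C" using L \<omega> by (auto simp: C_def C0_def intro!: mult_pos_pos add_pos_pos)
  have "rel_cap s p \<Sigma> (ball x0 R) * (\<integral>\<^sup>+x\<in>ball x0 r. ennreal (\<bar>u x\<bar> powr p) \<partial>lborel)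
        \<le> ennreal (C * R powr N * (R / (R - r)) powr p) * gagliardo_energy s p (ball x0 R \<times> UNIV) u"
    if s: "0 < s" "s < 1" and r: "0 < r" "r < R" and \<Sigma>: "\<Sigma> \<subseteq> cball x0 r"
      and u: "smooth u" "\<And>x. x \<in> \<Sigma> \<Longrightarrow> u x = 0"
    for s r R \<Sigma> u and x0 :: 'a
  proof -
    define \<delta> where "\<delta> = (R - r) / L"
    have \<delta>: "0 < \<delta>" "\<delta> \<le> R"
    proof -
      show "0 < \<delta>" using r L by (simp add: \<delta>_def)
      have "\<delta> \<le> (R - r) / 1" unfolding \<delta>_def using r L by (intro divide_left_mono) auto
      then show "\<delta> \<le> R" using r by simp
    qed
    obtain \<eta> where \<eta>: "\<eta> \<in> test_functions (ball x0 R)" "\<forall>x\<in>cball x0 r. \<eta> x = 1"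
        "\<forall>x. 0 \<le> \<eta> x \<and> \<eta> x \<le> 1" "\<forall>x y. \<bar>\<eta> x - \<eta> y\<bar> \<le> L / (R - r) * norm (x - y)"
      using cutoff[OF r] by blast
    have \<eta>_one: "\<eta> x = 1" if "x \<in> \<Sigma>" for x using \<eta>(2) \<Sigma> that by blast
    have \<eta>_lip: "\<bar>\<eta> x - \<eta> y\<bar> \<le> norm (x - y) / \<delta>" for x y
      using \<eta>(4) by (simp add: \<delta>_def mult.commute)
    define B where "B = ball x0 R"
    have [measurable]: "B \<in> sets borel" "ball x0 r \<in> sets borel" by (simp_all add: B_def)
    have [measurable]: "u \<in> borel_measurable borel"
      using smooth_continuous[OF u(1)] by (rule borel_measurable_continuous_onI)
    define \<kappa> where "\<kappa> = rel_cap s p \<Sigma> B"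
    define E where "E = gagliardo_energy s p (B \<times> UNIV) u"
    define K where "K = lipschitz_kernel_mass TYPE('a) s p \<delta>"
    define m where "m = emeasure lborel B"
    define D where "D c = (\<integral>\<^sup>+x\<in>B. ennreal (\<bar>u x - c\<bar> powr p) \<partial>lborel)" for c
    define I where "I = (\<integral>\<^sup>+x\<in>ball x0 r. ennreal (\<bar>u x\<bar> powr p) \<partial>lborel)"
    have [measurable]: "D \<in> borel_measurable borel" unfolding D_def by measurable
    have R: "0 < R" using r by simp
    have m: "m = ennreal (\<omega> * R powr N)"
      using R by (simp add: m_def B_def emeasure_ball \<omega>_def N_def powr_realpow)
    have cap_c: "ennreal (\<bar>c\<bar> powr p) * \<kappa> \<le> ennreal (2 powr p) * (E + K * D c)" for c
      unfolding \<kappa>_def E_def K_def D_def B_def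
      by (rule rel_cap_test_inequality[OF p u \<eta>(1) \<eta>_one _ _ \<eta>_lip]) (use \<eta>(3) in auto)
    have cap_1: "\<kappa> \<le> ennreal (2 powr p) * (K * m)"
    proof -
      have "ennreal (\<bar>1\<bar> powr p) * \<kappa> \<le>
          ennreal (2 powr p) * (gagliardo_energy s p (ball x0 R \<times> UNIV) (\<lambda>x. 0)
          + K * (\<integral>\<^sup>+x\<in>ball x0 R. ennreal (\<bar>0 - 1\<bar> powr p) \<partial>lborel))"
        unfolding \<kappa>_def K_def B_def
        by (rule rel_cap_test_inequality[OF p smooth_const _ \<eta>(1) \<eta>_one _ _ \<eta>_lip]) (use \<eta>(3) in auto)
      then show ?thesis by (simp add: gagliardo_energy_def m_def B_def case_prod_unfold)
    qed
    have pointwise: "\<kappa> * I \<le> ennreal (4 powr p) * (m * E + 2 * K * m * D c)" for c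
    proof -
      have "I \<le> (\<integral>\<^sup>+x\<in>B. ennreal (2 powr (p - 1))
          * (ennreal (\<bar>c\<bar> powr p) + ennreal (\<bar>u x - c\<bar> powr p)) \<partial>lborel)"
        unfolding I_def
      proof (intro nn_integral_mono)
        fix x
        have "ennreal (\<bar>u x\<bar> powr p) \<le>
            ennreal (2 powr (p - 1)) * (ennreal (\<bar>c\<bar> powr p) + ennreal (\<bar>u x - c\<bar> powr p))"
          using powr_abs_add_le[OF p, of c "u x - c"]
          by (simp add: ennreal_mult'[symmetric] ennreal_plus[symmetric] del: ennreal_plus)
        then show "ennreal (\<bar>u x\<bar> powr p) * indicator (ball x0 r) x \<le>
            ennreal (2 powr (p - 1)) * (ennreal (\<bar>c\<bar> powr p) + ennreal (\<bar>u x - c\<bar> powr p))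
                * indicator B x"
          using r by (auto simp: indicator_def B_def)
      qed
      also have "\<dots> = ennreal (2 powr (p - 1)) * (ennreal (\<bar>c\<bar> powr p) * m + D c)"
        by (simp add: mult.assoc distrib_right nn_integral_cmult nn_integral_add D_def m_def)
      finally have "\<kappa> * I \<le> \<kappa> * (ennreal (2 powr (p - 1)) * (ennreal (\<bar>c\<bar> powr p) * m + D c))"
        by (rule mult_left_mono) simp
      also have "\<dots> = ennreal (2 powr (p - 1)) * ((ennreal (\<bar>c\<bar> powr p) * \<kappa>) * m + \<kappa> * D c)"
        by (simp add: distrib_left mult_ac)
      also have "\<dots> \<le> ennreal (2 powr (p - 1))
          * (ennreal (2 powr p) * (E + K * D c) * m + ennreal (2 powr p) * (K * m) * D c)"
        by (intro mult_left_mono add_mono mult_right_mono cap_c cap_1) simp_all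
      also have "\<dots> = ennreal (2 powr (p - 1) * 2 powr p) * (m * E + 2 * K * m * D c)"
        by (simp add: ennreal_mult' distrib_left distrib_right mult_2 mult_ac add_ac)
      also have "\<dots> \<le> ennreal (4 powr p) * (m * E + 2 * K * m * D c)"
      proof (intro mult_right_mono ennreal_leI)
        have "(2::real) powr (p - 1) * 2 powr p \<le> 2 powr p * 2 powr p"
          by (intro mult_right_mono powr_mono) auto
        then show "2 powr (p - 1) * 2 powr p \<le> 4 powr p" by (simp add: powr_mult[symmetric])
      qed simp
      finally show ?thesis .
    qed
    have "m * (\<kappa> * I) = (\<integral>\<^sup>+y\<in>B. \<kappa> * I \<partial>lborel)"
      by (subst nn_integral_cmult_indicator) (simp_all add: m_def mult.commute)
    also have "\<dots> \<le> (\<integral>\<^sup>+y\<in>B. ennreal (4 powr p) * (m * E + 2 * K * m * D (u y)) \<partial>lborel)"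
      by (intro nn_integral_mono mult_right_mono pointwise) simp
    also have "\<dots> = ennreal (4 powr p) * (m * E * m + 2 * K * m * (\<integral>\<^sup>+y\<in>B. D (u y) \<partial>lborel))"
      by (simp add: mult.assoc distrib_right nn_integral_cmult nn_integral_add m_def)
    also have "(\<integral>\<^sup>+y\<in>B. D (u y) \<partial>lborel) = oscillation p B u"
      using nn_integral_set_times[of "\<lambda>x y. ennreal (\<bar>u x - u y\<bar> powr p)" B B]
      by (simp add: D_def oscillation_def abs_minus_commute)
    also have "ennreal (4 powr p) * (m * E * m + 2 * K * m * oscillation p B u) =
        m * (ennreal (4 powr p) * (m * E + 2 * (K * oscillation p B u)))"
      by (simp add: distrib_left mult_ac)
    finally have "\<kappa> * I \<le> ennreal (4 powr p) * (m * E + 2 * (K * oscillation p B u))"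
      using \<omega> R by (subst (asm) ennreal_mult_le_mult_iff) (simp_all add: m)
    also have "\<dots> \<le> ennreal (4 powr p)
        * (m * E + 2 * (ennreal (2 * 8 powr (N + p) * \<omega> * R ^ DIM('a) * (R / \<delta>) powr p) * E))"
      unfolding K_def B_def E_def N_def \<omega>_def
      by (intro mult_left_mono add_left_mono kernel_mass_times_oscillation p s \<delta>) simp_all
    also have "\<dots> = ennreal (4 powr p * (\<omega> * R powr N + C0 * \<omega> * R powr N * (R / \<delta>) powr p)) * E"
    proof -
      have "2 * (ennreal (2 * 8 powr (N + p) * \<omega> * R ^ DIM('a) * (R / \<delta>) powr p) * E)
          = ennreal (C0 * \<omega> * R powr N * (R / \<delta>) powr p) * E"
        using R by (simp add: C0_def N_def powr_realpow mult.assoc[symmetric]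
          ennreal_mult'[symmetric] flip: ennreal_numeral)
      then show ?thesis
        using \<omega> by (simp add: m ennreal_mult' C0_def distrib_right mult.assoc)
    qed
    also have "\<dots> \<le> ennreal (C * R powr N * (R / (R - r)) powr p) * E"
    proof (intro mult_right_mono ennreal_leI)
      have ratio: "1 \<le> (R / \<delta>) powr p" using \<delta> p by (intro ge_one_powr_ge_zero) auto
      have "\<omega> * R powr N * 1 \<le> \<omega> * R powr N * (R / \<delta>) powr p"
        by (intro mult_left_mono ratio) (use \<omega> in auto)
      then have "4 powr p * (\<omega> * R powr N + C0 * \<omega> * R powr N * (R / \<delta>) powr p)
          \<le> 4 powr p * (\<omega> * R powr N * (R / \<delta>) powr p + C0 * \<omega> * R powr N * (R / \<delta>) powr p)"
        using ratio \<omega> by (intro mult_left_mono add_mono) (auto simp: C0_def)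
      also have "\<dots> = 4 powr p * (1 + C0) * \<omega> * R powr N * (R / \<delta>) powr p"
        by (simp add: algebra_simps)
      also have "\<dots> = C * R powr N * (R / (R - r)) powr p"
      proof -
        have "R / \<delta> = L * (R / (R - r))" by (simp add: \<delta>_def)
        moreover have "(L * (R / (R - r))) powr p = L powr p * (R / (R - r)) powr p"
          using L R r by (subst powr_mult) auto
        ultimately show ?thesis by (simp add: C_def mult_ac)
      qed
      finally show "4 powr p * (\<omega> * R powr N + C0 * \<omega> * R powr N * (R / \<delta>) powr p) \<le>
          C * R powr N * (R / (R - r)) powr p" .
    qed simp
    finally show ?thesis by (simp add: \<kappa>_def I_def E_def B_def)
  qed
  then show ?thesis
    using C by (intro exI[of _ C]) (auto simp: N_def)
qed

section \<open>Passing to roots and choosing the constant\<close>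

lemma ennreal_powr_mono: "x \<le> y \<Longrightarrow> 0 \<le> a \<Longrightarrow> ennreal_powr x a \<le> ennreal_powr y a"
  by (auto simp: ennreal_powr_def top_unique less_top intro!: ennreal_leI powr_mono2 enn2real_mono)

lemma ennreal_powr_ennreal: "0 \<le> x \<Longrightarrow> ennreal_powr (ennreal x) a = ennreal (x powr a)"
  by (simp add: ennreal_powr_def)

text \<open>
Infinite factors cause no trouble: \<open>0 * \<infinity> = 0\<close> agrees with \<open>0 powr a = 0\<close>.
\<close>
lemma ennreal_powr_mult: "ennreal_powr (x * y) a = ennreal_powr x a * ennreal_powr y a"
proof -
  consider "x = 0 \<or> y = 0" | "x \<noteq> 0" "y \<noteq> 0" "x = \<infinity> \<or> y = \<infinity>" | "x \<noteq> \<infinity>" "y \<noteq> \<infinity>" by blast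
  then show ?thesis
  proof cases
    case 1
    then show ?thesis by (auto simp: ennreal_powr_def)
  next
    case 2
    then have pos: "ennreal_powr x a \<noteq> 0" "ennreal_powr y a \<noteq> 0"
      by (auto simp: ennreal_powr_def enn2real_eq_0_iff)
    have "ennreal_powr x a = \<infinity> \<or> ennreal_powr y a = \<infinity>" "x * y = \<infinity>"
      using 2 by (auto simp: ennreal_powr_def ennreal_mult_eq_top_iff)
    then have "ennreal_powr x a * ennreal_powr y a = \<infinity>"
      using pos by (auto simp: ennreal_mult_eq_top_iff)
    then show ?thesis using \<open>x * y = \<infinity>\<close> by (simp add: ennreal_powr_def)
  next
    case 3
    then show ?thesis
      by (auto simp: ennreal_powr_def ennreal_mult_eq_top_iff enn2real_mult powr_mult ennreal_mult')
  qed
qed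

theorem lemma4p4:
  fixes p :: real
  assumes "1 \<le> p"
  shows "\<exists>M :: real \<Rightarrow> real.
    (\<forall>t>1. 0 < M t) \<and>
    (\<forall>(s::real) (x0 :: real ^ 'n) (r::real) (R::real) \<Sigma> u.
       0 < s \<longrightarrow> s < 1 \<longrightarrow> 0 < r \<longrightarrow> r < R \<longrightarrow>
       compact \<Sigma> \<longrightarrow> \<Sigma> \<subseteq> closure (ball x0 r) \<longrightarrow>
       u \<in> test_functions UNIV \<longrightarrow> (\<forall>x\<in>\<Sigma>. u x = 0) \<longrightarrow>
       ennreal (M (R / r) / r powr (real CARD('n) / p))
         * ennreal_powr (rel_cap s p \<Sigma> (ball x0 R)) (1 / p)
         * Lp_norm p (ball x0 r) u
       \<le> ennreal_powr (gagliardo_energy s p (ball x0 R \<times> UNIV) u) (1 / p)) \<and>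
    (\<exists>L>0. ((\<lambda>t. M t / (t - 1) powr (real CARD('n) / p + 1)) \<longlongrightarrow> L) (at_right 1)) \<and>
    (\<exists>L>0. ((\<lambda>t. t powr (real CARD('n) / p) * M t) \<longlongrightarrow> L) at_top)"
proof -
  define N where "N = real CARD('n)"
  obtain C where C: "0 < C" and ineq:
    "\<forall>s (x0::real ^ 'n) r R \<Sigma> u. 0 < s \<longrightarrow> s < 1 \<longrightarrow> 0 < r \<longrightarrow> r < R \<longrightarrow>
      \<Sigma> \<subseteq> cball x0 r \<longrightarrow> smooth u \<longrightarrow> (\<forall>x\<in>\<Sigma>. u x = 0) \<longrightarrow>
      rel_cap s p \<Sigma> (ball x0 R) * (\<integral>\<^sup>+x\<in>ball x0 r. ennreal (\<bar>u x\<bar> powr p) \<partial>lborel)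
        \<le> ennreal (C * R powr N * (R / (R - r)) powr p) * gagliardo_energy s p (ball x0 R \<times> UNIV) u"
    using rel_cap_mult_integral_le[OF assms, where 'a = "real ^ 'n"] by (auto simp: N_def)
  define e where "e = N / p + 1"
  define c where "c = C powr (- 1 / p)"
  have c: "0 < c" using C by (simp add: c_def)
  \<comment> \<open>The power-\<open>p\<close> inequality gives \<open>M t = c * t powr (- N / p) * ((t - 1) / t)\<close>. Since
    \<open>(t - 1) / t < 1\<close>, raising the last factor to the power \<open>e\<close> only lowers \<open>M\<close>; it produces the
    prescribed rate at \<open>t = 1\<close> and does not affect that at infinity.\<close>
  define M where "M t = c * t powr (- N / p) * ((t - 1) / t) powr e" for t
  have "0 < M t" if "1 < t" for t using that c by (simp add: M_def)
  moreover have "ennreal (M (R / r) / r powr (N / p))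
         * ennreal_powr (rel_cap s p \<Sigma> (ball x0 R)) (1 / p)
         * Lp_norm p (ball x0 r) u
       \<le> ennreal_powr (gagliardo_energy s p (ball x0 R \<times> UNIV) u) (1 / p)"
    if s: "0 < s" "s < 1" and r: "0 < r" "r < R" and \<Sigma>: "\<Sigma> \<subseteq> closure (ball x0 r)"
      and u: "u \<in> test_functions UNIV" "\<forall>x\<in>\<Sigma>. u x = 0"
    for s r R \<Sigma> u and x0 :: "real ^ 'n"
  proof -
    define A where "A = C * R powr N * (R / (R - r)) powr p"
    define E where "E = gagliardo_energy s p (ball x0 R \<times> UNIV) u"
    have A: "0 \<le> A" using C by (simp add: A_def)
    have "rel_cap s p \<Sigma> (ball x0 R) * (\<integral>\<^sup>+x\<in>ball x0 r. ennreal (\<bar>u x\<bar> powr p) \<partial>lborel) \<le> ennreal A * E"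
      unfolding A_def E_def using ineq s r \<Sigma> u by (auto simp: test_functions_def)
    then have "ennreal_powr (rel_cap s p \<Sigma> (ball x0 R)) (1 / p) * Lp_norm p (ball x0 r) u \<le>
        ennreal (A powr (1 / p)) * ennreal_powr E (1 / p)"
      unfolding Lp_norm_def ennreal_powr_mult[symmetric] ennreal_powr_ennreal[OF A, symmetric]
      by (rule ennreal_powr_mono) (use assms in simp)
    then have "ennreal (M (R / r) / r powr (N / p))
        * (ennreal_powr (rel_cap s p \<Sigma> (ball x0 R)) (1 / p) * Lp_norm p (ball x0 r) u)
        \<le> ennreal (M (R / r) / r powr (N / p)) * (ennreal (A powr (1 / p)) * ennreal_powr E (1 / p))"
      by (rule mult_left_mono) simp
    also have "\<dots> = ennreal (M (R / r) / r powr (N / p) * A powr (1 / p)) * ennreal_powr E (1 / p)"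
      by (simp only: ennreal_mult''[OF powr_ge_zero] mult.assoc)
    also have "\<dots> \<le> ennreal 1 * ennreal_powr E (1 / p)"
    proof (intro mult_right_mono ennreal_leI)
      define \<rho> where "\<rho> = (R - r) / R"
      have \<rho>: "0 < \<rho>" "\<rho> \<le> 1" and R: "0 < R" using r by (auto simp: \<rho>_def)
      have A_root: "A powr (1 / p) = C powr (1 / p) * R powr (N / p) / \<rho>"
      proof -
        have "R / (R - r) = 1 / \<rho>" by (simp add: \<rho>_def)
        then show ?thesis using C R \<rho> assms by (simp add: A_def powr_mult powr_powr powr_divide)
      qed
      have M_eq: "M (R / r) / r powr (N / p) = c * R powr (- N / p) * \<rho> powr e"
      proof -
        have "(R / r - 1) / (R / r) = \<rho>" using r by (simp add: \<rho>_def field_simps)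
        then show ?thesis
          using r R by (simp add: M_def powr_divide powr_minus_divide)
      qed
      have "M (R / r) / r powr (N / p) * A powr (1 / p) =
          (c * C powr (1 / p)) * (R powr (- N / p) * R powr (N / p)) * (\<rho> powr e / \<rho>)"
        by (simp add: M_eq A_root)
      also have "\<dots> = \<rho> powr (N / p)"
        using C R \<rho> by (simp add: c_def powr_add[symmetric] e_def powr_add)
      also have "\<dots> \<le> 1"
        using \<rho> assms by (intro powr_le1) (auto simp: N_def)
      finally show "M (R / r) / r powr (N / p) * A powr (1 / p) \<le> 1" .
    qed simp
    finally show ?thesis by (simp add: E_def mult.assoc)
  qed
  moreover have "((\<lambda>t. M t / (t - 1) powr (N / p + 1)) \<longlongrightarrow> c) (at_right 1)"
  proof (rule Lim_transform_eventually)
    have "((\<lambda>t::real. c * t powr (- N / p) * t powr (- e)) \<longlongrightarrow> c * 1 powr (- N / p)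
        * 1 powr (- e)) (at_right 1)"
      by (intro tendsto_intros) auto
    then show "((\<lambda>t::real. c * t powr (- N / p) * t powr (- e)) \<longlongrightarrow> c) (at_right 1)" by simp
    show "\<forall>\<^sub>F t in at_right 1. c * t powr (- N / p) * t powr (- e) = M t / (t - 1) powr (N / p + 1)"
      unfolding eventually_at_filter e_def[symmetric]
      by (auto simp: M_def powr_divide powr_minus_divide)
  qed
  moreover have "((\<lambda>t. t powr (N / p) * M t) \<longlongrightarrow> c) at_top"
  proof (rule Lim_transform_eventually)
    have "((\<lambda>t::real. c * (1 - inverse t) powr e) \<longlongrightarrow> c * (1 - 0) powr e) at_top"
      by (intro tendsto_intros tendsto_inverse_0_at_top filterlim_ident) auto
    then show "((\<lambda>t::real. c * (1 - inverse t) powr e) \<longlongrightarrow> c) at_top" by simp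
    show "\<forall>\<^sub>F t in at_top. c * (1 - inverse t) powr e = t powr (N / p) * M t"
      using eventually_gt_at_top[of 1]
    proof eventually_elim
      case (elim t)
      then have "(t - 1) / t = 1 - inverse t" "t powr (N / p) * t powr (- N / p) = 1"
        by (auto simp: field_simps powr_add[symmetric])
      then show ?case by (simp add: M_def mult_ac)
    qed
  qed
  ultimately show ?thesis
    using c unfolding N_def[symmetric] by (intro exI[of _ M]) auto
qed

end
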